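(* If $n\in\mathbf N$ and $k_1,\dots,k_n,\ell_1,\dots,\ell_n\in\mathbf N\cup\{0\}$, then \begin{align*} N(k_1,\ell_1,\dots,k_n,\ell_n)=&\sum_{r=1}^n\ \sum_{1\le j(1)<\dots<j(r)\le n}\operatorname{Nom}(\ell_1,\dots,\ell_n;j(1),\dots,j(r))\\ &\cdot\bigg(N(k_1,\ell_1,\dots,k_{j(1)-1},\ell_{j(1)-1},k_{j(1)}-1,\ \ell_{j(r)}-1,k_{j(r)+1},\ell_{j(r)+1},\dots,k_n,\ell_n)\\ &\quad\cdot\prod_{i=1}^{r-1}N(\ell_{j(i)}-1,k_{j(i)+1},\ell_{j(i)+1},\dots,k_{j(i+1)-1},\ell_{j(i+1)-1},k_{j(i+1)}-1)\bigg), \end{align*} where $\operatorname{Nom}(\ell_1,\dots,\ell_n;j(1),\dots,j(r))$ is the multinomial coefficient $$\binom{\ell_1+\dots+\ell_n}{\ell_1+\dots+\ell_{j(1)-1}+\ell_{j(r)}+\dots+\ell_n,\ \ \ell_{j(1)}+\dots+\ell_{j(2)-1},\ \dots,\ \ell_{j(r-1)}+\dots+\ell_{j(r)-1}}.$$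
   Context: **The operator $T$.** $T$ is the quasi-nilpotent $\mathrm{DT}(\delta_0,1)$-operator, and $\tau$ is the unique normalized trace on the von Neumann algebra generated by $T$. It is realized as the limit in $*$-moments of strictly upper triangular random matrices with i.i.d. complex Gaussian entries: for every word $p(T^*,T)$ in $T^*$ and $T$, $$\tau(p(T^*,T))=\lim_{d\to\infty}\mathbb E\Big[\tfrac1d\operatorname{Tr}\,p(T_d^*,T_d)\Big],$$ where $T_d$ is the random $d\times d$ matrix that is zero on and below the diagonal and whose entries strictly above the diagonal are i.i.d. complex Gaussian with mean $0$ and $\mathbb E|t|^2=1/d$ (real and imaginary parts independent, each of variance $1/(2d)$). **The numbers $N$ (with entries $-1$ allowed).** Here $\mathbf N=\{1,2,\dots\}$. Let $n\in\mathbf N$ and $k_1,\dots,k_n,\ell_1,\dots,\ell_n\in\mathbf N\cup\{0,-1\}$. If $k_1+\dots+k_n\ne\ell_1+\dots+\ell_n$, set $N(k_1,\ell_1,\dots,k_n,\ell_n)=0$. Suppose now $k_1+\dots+k_n=\ell_1+\dots+\ell_n=:m$. - If $k_j\ge0$ and $\ell_j\ge0$ for all $j$, let $N(k_1,\ell_1,\dots,k_n,\ell_n)=(m+1)!\,\tau\big((T^* )^{k_1}T^{\ell_1}\cdots(T^* )^{k_n}T^{\ell_n}\big)$. - If $n=1$ and $k_1=\ell_1=-1$, let $N(-1,-1)=1$. - In all other cases (where $n\ge2$ and $k_j=-1$ or $\ell_j=-1$ for some $j$), let $N(k_1,\ell_1,\dots,k_n,\ell_n)=0$. **Conventions.** For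 $r=1$ the product over $i$ is empty, equal to $1$, the multinomial coefficient has the single block $\ell_1+\dots+\ell_n$ and equals $1$, and the first $N$-factor is $N(k_1,\ell_1,\dots,k_{j(1)}-1,\ell_{j(1)}-1,\dots,k_n,\ell_n)$. If $j(i+1)=j(i)+1$, the corresponding factor in the product is $N(\ell_{j(i)}-1,k_{j(i+1)}-1)$. If $j(1)=1$ (resp. $j(r)=n$), the entries with index less than $j(1)$ (resp. greater than $j(r)$) are absent from the first $N$-factor. *)

theory Defs
  imports "HOL-Probability.Probability" "Jordan_Normal_Form.Schur_Decomposition"
begin

text \<open>The inner product is linear in its first argument. Positive definiteness is implied by
  \<open>norm_cinner\<close>, since \<open>norm\<close> is a norm; completeness comes from \<open>banach\<close>.\<close>

class complex_hilbert_space = banach +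
  fixes cscale :: "complex \<Rightarrow> 'a \<Rightarrow> 'a"
    and cinner :: "'a \<Rightarrow> 'a \<Rightarrow> complex"
  assumes cscale_add_right: "cscale c (x + y) = cscale c x + cscale c y"
    and cscale_add_left: "cscale (a + b) x = cscale a x + cscale b x"
    and cscale_cscale: "cscale a (cscale b x) = cscale (a * b) x"
    and cscale_of_real: "cscale (complex_of_real r) x = scaleR r x"
    and cinner_commute: "cinner x y = cnj (cinner y x)"
    and cinner_add_left: "cinner (x + y) z = cinner x z + cinner y z"
    and cinner_cscale_left: "cinner (cscale c x) y = c * cinner x y"
    and norm_cinner: "norm x = sqrt (Re (cinner x x))"

text \<open>The type of bounded linear functions of the library is that of real-linear ones, so complex
  linearity has to be required separately.\<close>

definition cbounded_ops :: "('h::complex_hilbert_space \<Rightarrow>\<^sub>L 'h) set" where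
  "cbounded_ops = {A. \<forall>c x. blinfun_apply A (cscale c x) = cscale c (blinfun_apply A x)}"

definition op_adjoint :: "('h::complex_hilbert_space \<Rightarrow>\<^sub>L 'h) \<Rightarrow> ('h \<Rightarrow>\<^sub>L 'h)" where
  "op_adjoint A = (THE B. \<forall>x y. cinner (blinfun_apply A x) y = cinner x (blinfun_apply B y))"

definition op_commutant :: "('h::complex_hilbert_space \<Rightarrow>\<^sub>L 'h) set \<Rightarrow> ('h \<Rightarrow>\<^sub>L 'h) set" where
  "op_commutant S = {A \<in> cbounded_ops. \<forall>B\<in>S. A o\<^sub>L B = B o\<^sub>L A}"

text \<open>By the double commutant theorem this is the von Neumann algebra generated by \<open>T\<close>.\<close>

definition vN_generated :: "('h::complex_hilbert_space \<Rightarrow>\<^sub>L 'h) \<Rightarrow> ('h \<Rightarrow>\<^sub>L 'h) set" where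
  "vN_generated T = op_commutant (op_commutant {T, op_adjoint T})"

text \<open>A trace is only meaningful on the algebra \<open>M\<close>; its values outside \<open>M\<close> are irrelevant.\<close>

definition normalized_trace ::
  "('h::complex_hilbert_space \<Rightarrow>\<^sub>L 'h) set \<Rightarrow> (('h \<Rightarrow>\<^sub>L 'h) \<Rightarrow> complex) \<Rightarrow> bool" where
  "normalized_trace M \<tau> \<longleftrightarrow>
     (\<forall>A\<in>M. \<forall>B\<in>M. \<tau> (A + B) = \<tau> A + \<tau> B) \<and>
     (\<forall>A\<in>M. \<forall>B\<in>M. \<forall>c. (\<forall>x. blinfun_apply B x = cscale c (blinfun_apply A x)) \<longrightarrow> \<tau> B = c * \<tau> A) \<and>
     (\<forall>A\<in>M. \<tau> (op_adjoint A o\<^sub>L A) \<in> \<real>\<^sub>\<ge>\<^sub>0) \<and>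
     (\<forall>A\<in>M. \<forall>B\<in>M. \<tau> (A o\<^sub>L B) = \<tau> (B o\<^sub>L A)) \<and>
     \<tau> id_blinfun = 1"

datatype letter = Star | Plain

type_synonym word = "letter list"

definition op_word :: "('h::complex_hilbert_space \<Rightarrow>\<^sub>L 'h) \<Rightarrow> word \<Rightarrow> ('h \<Rightarrow>\<^sub>L 'h)" where
  "op_word T w =
     foldr (\<lambda>a B. (case a of Star \<Rightarrow> op_adjoint T | Plain \<Rightarrow> T) o\<^sub>L B) w id_blinfun"

definition mat_word :: "nat \<Rightarrow> complex Matrix.mat \<Rightarrow> word \<Rightarrow> complex Matrix.mat" where
  "mat_word d X w =
     foldr (\<lambda>a B. (case a of Star \<Rightarrow> mat_adjoint X | Plain \<Rightarrow> X) * B) w (1\<^sub>m d)"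

text \<open>The law of a complex Gaussian \<open>t\<close> with mean 0 and \<open>E |t|^2 = v\<close>: real and imaginary part
  are independent centred normal variables of variance \<open>v / 2\<close>. The second parameter of
  \<open>normal_density\<close> is the standard deviation.\<close>

definition complex_gaussian :: "real \<Rightarrow> complex measure" where
  "complex_gaussian v =
     distr (density lborel (normal_density 0 (sqrt (v / 2))) \<Otimes>\<^sub>M
            density lborel (normal_density 0 (sqrt (v / 2))))
       borel (\<lambda>(x, y). Complex x y)"

definition entries_measure :: "nat \<Rightarrow> (nat \<times> nat \<Rightarrow> complex) measure" where
  "entries_measure d = PiM {(i, j). i < j \<and> j < d} (\<lambda>_. complex_gaussian (1 / real d))"

definition upper_mat :: "nat \<Rightarrow> (nat \<times> nat \<Rightarrow> complex) \<Rightarrow> complex Matrix.mat" where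
  "upper_mat d t = Matrix.mat d d (\<lambda>(i, j). if i < j then t (i, j) else 0)"

definition mat_moment :: "nat \<Rightarrow> word \<Rightarrow> complex" where
  "mat_moment d w =
     (\<integral>t. (1 / of_nat d) * (\<Sum>i<d. mat_word d (upper_mat d t) w $$ (i, i)) \<partial>entries_measure d)"

text \<open>Faithfulness and uniqueness of \<open>\<tau>\<close> make the generated von Neumann algebra a finite factor
  (so \<open>\<tau>\<close> is normal), and the \<open>*\<close>-moments then determine \<open>T\<close> up to a trace preserving
  isomorphism of the generated von Neumann algebras.\<close>

definition quasinilpotent_DT ::
  "('h::complex_hilbert_space \<Rightarrow>\<^sub>L 'h) \<Rightarrow> (('h \<Rightarrow>\<^sub>L 'h) \<Rightarrow> complex) \<Rightarrow> bool" where
  "quasinilpotent_DT T \<tau> \<longleftrightarrow>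
     T \<in> cbounded_ops \<and>
     normalized_trace (vN_generated T) \<tau> \<and>
     (\<forall>\<sigma>. normalized_trace (vN_generated T) \<sigma> \<longrightarrow> (\<forall>A\<in>vN_generated T. \<sigma> A = \<tau> A)) \<and>
     (\<forall>A\<in>vN_generated T. \<tau> (op_adjoint A o\<^sub>L A) = 0 \<longrightarrow> A = 0) \<and>
     (\<forall>w. (\<lambda>d. mat_moment d w) \<longlonglongrightarrow> \<tau> (op_word T w))"

fun pair_up :: "'a list \<Rightarrow> ('a \<times> 'a) list" where
  "pair_up (x # y # zs) = (x, y) # pair_up zs"
| "pair_up _ = []"

definition alt_word :: "(int \<times> int) list \<Rightarrow> word" where
  "alt_word ps = concat (map (\<lambda>(k, l). replicate (nat k) Star @ replicate (nat l) Plain) ps)"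

text \<open>The argument is the alternating list \<open>[k\<^sub>1, l\<^sub>1, \<dots>, k\<^sub>n, l\<^sub>n]\<close> with entries \<open>\<ge> -1\<close> and
  \<open>n \<ge> 1\<close>; on other lists the value has no meaning.\<close>

definition DT_N ::
  "('h::complex_hilbert_space \<Rightarrow>\<^sub>L 'h) \<Rightarrow> (('h \<Rightarrow>\<^sub>L 'h) \<Rightarrow> complex) \<Rightarrow> int list \<Rightarrow> complex" where
  "DT_N T \<tau> xs =
     (let ps = pair_up xs; m = sum_list (map fst ps) in
      if m \<noteq> sum_list (map snd ps) then 0
      else if \<forall>(k, l)\<in>set ps. k \<ge> 0 \<and> l \<ge> 0 then fact (nat m + 1) * \<tau> (op_word T (alt_word ps))
      else if ps = [(-1, -1)] then 1
      else 0)"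

text \<open>The stretch \<open>k\<^sub>a, l\<^sub>a, \<dots>, k\<^sub>b\<^sub>-\<^sub>1, l\<^sub>b\<^sub>-\<^sub>1\<close> of the alternating list; empty if \<open>b \<le> a\<close>.\<close>

definition alternate :: "(nat \<Rightarrow> nat) \<Rightarrow> (nat \<Rightarrow> nat) \<Rightarrow> nat \<Rightarrow> nat \<Rightarrow> int list" where
  "alternate k l a b = concat (map (\<lambda>s. [int (k s), int (l s)]) [a..<b])"

definition multinomial :: "nat \<Rightarrow> nat list \<Rightarrow> nat" where
  "multinomial m bs = fact m div prod_list (map fact bs)"

definition Nom :: "nat \<Rightarrow> (nat \<Rightarrow> nat) \<Rightarrow> nat \<Rightarrow> (nat \<Rightarrow> nat) \<Rightarrow> nat" where
  "Nom n l r j =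
     multinomial (\<Sum>s=1..n. l s)
       (((\<Sum>s\<in>{1..<j 1}. l s) + (\<Sum>s\<in>{j r..n}. l s))
         # map (\<lambda>i. \<Sum>s\<in>{j i..<j (i + 1)}. l s) [1..<r])"

end

theory Submission
  imports Defs "HOL-Library.Poly_Mapping" "HOL-Real_Asymp.Real_Asymp"
begin

text \<open>Expand a \<open>*\<close>-moment of the strictly upper triangular random matrix over closed walks on its
  indices: \<open>T\<close> steps upwards, \<open>T\<^sup>*\<close> downwards. To leading order such a walk runs once around a plane
  tree, so \<open>N\<close> counts plane trees with an increasing labelling of their \<open>m + 1\<close> vertices. The recursion
  classifies these objects by what happens at the least vertex. The walk can be there only in the
  gaps between \<open>(T\<^sup>*)\<^sup>k\<close> and \<open>T\<^sup>l\<close>; the indices \<open>j(1) < \<dots> < j(r)\<close> are those of the gaps where it is.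
  Removing the least vertex leaves one subtree for every excursion from it, hence one factor \<open>N\<close> per
  excursion, and the multinomial coefficient distributes the remaining \<open>m\<close> labels over the subtrees.
  An excursion leaves by \<open>T\<close> and returns by \<open>T\<^sup>*\<close>; these two letters are the entries lowered by one.
  Values at \<open>-1\<close> see to zero exponents: a gap that coincides with its neighbour has to be visited
  together with it, which is \<open>N(-1, -1) = 1\<close>, and all other choices contribute nothing.

  No tree is constructed below. The least vertex is removed at finite matrix size instead, which
  means splitting off the first row \<open>v\<close>. As a polynomial in the entries, the trace of a word in the larger
  matrix is its trace in the smaller one plus a sum, over the possible sets of visits, of products of
  forms \<open>v u v\<^sup>*\<close>, where \<open>u\<close> is the word of an excursion (\<open>word_trace_visits\<close>). The row is Gaussian and
  independent of the rest, so integrating it out turns each \<open>v u v\<^sup>*\<close> into the trace of \<open>u\<close>, up to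
  terms in which two excursions are merged (\<open>gexp_contract\<close>). All joint moments of traces therefore
  satisfy one exact recursion in the size of the matrix (\<open>gexp_word_trace\<close>).

  Merging two excursions, and visiting the new vertex in two traces at once, both cost a power of
  the size \<open>d\<close>. By the Stolz-Cesaro theorem products of traces therefore factorise in the limit
  (\<open>factorises_all\<close>), and what survives of the recursion is that \<open>(m + 1) \<tau>(w)\<close> is the sum over the sets
  of visits of the products of \<open>\<tau>(u)\<close> over the excursions (\<open>visit_sum_value\<close>). This is the claim
  divided by \<open>m!\<close>. It remains to list the sets of visits of an alternating word as increasing maps
  (\<open>visit_sum_increasing_maps\<close>) and to restore the factorials (\<open>Nom_mult_facts\<close>). The \<open>N\<close>-factors of
  the inner excursions exchange \<open>T\<close> and \<open>T\<^sup>*\<close>. Reversing the order of the indices exchanges them as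
  well and preserves all moments (\<open>trace_moment_flip\<close>).\<close>

section \<open>Formal Gaussian polynomials\<close>

text \<open>The variable \<open>(i, j)\<close> stands for the entry of the Hermitian matrix \<open>T + T\<^sup>*\<close>, so exchanging the
  indices is complex conjugation, and \<open>T\<close> and \<open>T\<^sup>*\<close> become its parts above and below the diagonal. On
  formal polynomials the expectation is a total linear functional, the same for all matrix sizes;
  integrals enter when it is compared with the moments of the random matrix.\<close>
type_synonym gmonom = "(nat \<times> nat) multiset"
type_synonym gpoly = "gmonom \<Rightarrow>\<^sub>0 nat"

definition gvar :: "nat \<Rightarrow> nat \<Rightarrow> gpoly" where
  "gvar i j = Poly_Mapping.single {#(i, j)#} 1"

text \<open>Expectation, formal derivative and evaluation are all linear extensions of maps on monomials.\<close>
definition lin_ext :: "('m \<Rightarrow> 'r::comm_semiring_1) \<Rightarrow> ('m \<Rightarrow>\<^sub>0 nat) \<Rightarrow> 'r" where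
  "lin_ext f P = (\<Sum>m\<in>Poly_Mapping.keys P. of_nat (Poly_Mapping.lookup P m) * f m)"

lemma lin_ext_superset:
  assumes "finite S" "Poly_Mapping.keys P \<subseteq> S"
  shows "lin_ext f P = (\<Sum>m\<in>S. of_nat (Poly_Mapping.lookup P m) * f m)"
  unfolding lin_ext_def
  by (rule sum.mono_neutral_left) (use assms in \<open>auto simp: in_keys_iff\<close>)

lemma lin_ext_add: "lin_ext f (P + Q) = lin_ext f P + lin_ext f Q"
proof -
  let ?S = "Poly_Mapping.keys P \<union> Poly_Mapping.keys Q"
  have "Poly_Mapping.keys (P + Q) \<subseteq> ?S" by (rule Poly_Mapping.keys_add)
  then show ?thesis
    by (simp add: lin_ext_superset[where S = ?S] lookup_add sum.distrib algebra_simps)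
qed

lemma lin_ext_0 [simp]: "lin_ext f 0 = 0"
  by (simp add: lin_ext_def)

lemma lin_ext_sum: "lin_ext f (\<Sum>x\<in>A. g x) = (\<Sum>x\<in>A. lin_ext f (g x))"
  by (induction A rule: infinite_finite_induct) (auto simp: lin_ext_add)

lemma lin_ext_sum_list: "lin_ext f (\<Sum>x\<leftarrow>xs. g x) = (\<Sum>x\<leftarrow>xs. lin_ext f (g x))"
  by (induction xs) (auto simp: lin_ext_add)

lemma lin_ext_single [simp]: "lin_ext f (Poly_Mapping.single m c) = of_nat c * f m"
  by (cases "c = 0") (auto simp: lin_ext_def)

text \<open>With coefficients in the natural numbers every polynomial is a sum of monic monomials, so an
  additive identity has to be checked on those only.\<close>
lemma gpoly_induct [case_names zero single add]:
  fixes P :: "'m \<Rightarrow>\<^sub>0 nat"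
  assumes "Q 0" "\<And>m. Q (Poly_Mapping.single m 1)" "\<And>P R. Q P \<Longrightarrow> Q R \<Longrightarrow> Q (P + R)"
  shows "Q P"
proof (induction P rule: update_induct)
  case (update P m c)
  have *: "Q (Poly_Mapping.single m c)" for c
  proof (induction c)
    case (Suc c)
    have "Poly_Mapping.single m (Suc c) = Poly_Mapping.single m 1 + Poly_Mapping.single m c"
      by (simp flip: single_add)
    then show ?case using assms Suc by simp
  qed (simp add: assms)
  have "Poly_Mapping.update m c P = Poly_Mapping.single m c + P"
    using update.hyps
    by (intro poly_mapping_eqI) (auto simp: lookup_update lookup_add lookup_single when_def in_keys_iff)
  then show ?case using * update.IH assms(3) by simp
qed (use assms in auto)

lemma lin_ext_mult:
  assumes "\<And>m m'. f (m + m') = f m * f m'"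
  shows "lin_ext f (P * Q) = lin_ext f P * lin_ext f Q"
proof (induction P rule: gpoly_induct)
  case (single m)
  show ?case
    by (induction Q rule: gpoly_induct)
       (simp_all add: mult_single assms lin_ext_add distrib_left)
qed (simp_all add: distrib_right lin_ext_add)

definition gderiv :: "nat \<Rightarrow> nat \<Rightarrow> gpoly \<Rightarrow> gpoly" where
  "gderiv i j = lin_ext (\<lambda>m. Poly_Mapping.single (m - {#(i, j)#}) (count m (i, j)))"

lemma gderiv_add: "gderiv i j (P + Q) = gderiv i j P + gderiv i j Q"
  by (simp add: gderiv_def lin_ext_add)

lemma gderiv_0 [simp]: "gderiv i j 0 = 0"
  by (simp add: gderiv_def)

lemma gderiv_1 [simp]: "gderiv i j 1 = 0"
  by (simp add: gderiv_def flip: single_one)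

lemma gderiv_sum: "gderiv i j (\<Sum>x\<in>A. g x) = (\<Sum>x\<in>A. gderiv i j (g x))"
  by (simp add: gderiv_def lin_ext_sum)

lemma gderiv_gvar: "gderiv i j (gvar i' j') = (if i = i' \<and> j = j' then 1 else 0)"
  by (auto simp: gderiv_def gvar_def) (simp flip: single_one)

lemma gderiv_monom_mult:
  "gderiv i j (Poly_Mapping.single m 1 * Poly_Mapping.single m' 1) =
   gderiv i j (Poly_Mapping.single m 1) * Poly_Mapping.single m' 1 +
   Poly_Mapping.single m 1 * gderiv i j (Poly_Mapping.single m' 1)"
proof -
  have *: "Poly_Mapping.single (a + b - {#(i, j)#}) (count a (i, j)) =
    Poly_Mapping.single (a - {#(i, j)#} + b) (count a (i, j))" for a b :: gmonom
  proof (cases "(i, j) \<in># a")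
    case True
    then obtain a' where "a = add_mset (i, j) a'" by (metis insert_DiffM)
    then show ?thesis by simp
  qed (simp add: not_in_iff)
  have "gderiv i j (Poly_Mapping.single (m + m') 1) =
    Poly_Mapping.single (m + m' - {#(i, j)#}) (count m (i, j)) +
    Poly_Mapping.single (m' + m - {#(i, j)#}) (count m' (i, j))"
    by (simp add: gderiv_def add.commute[of m' m] flip: single_add)
  then show ?thesis unfolding *
    by (simp add: gderiv_def mult_single add.commute[of m])
qed

lemma gderiv_mult: "gderiv i j (P * Q) = gderiv i j P * Q + P * gderiv i j Q"
proof (induction P rule: gpoly_induct)
  case (single m)
  show ?case
  proof (induction Q rule: gpoly_induct)
    case (single m')
    show ?case by (rule gderiv_monom_mult)
  qed (simp_all add: gderiv_add algebra_simps)
qed (simp_all add: gderiv_add algebra_simps)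

text \<open>The expectation of a monomial in independent standard complex Gaussians \<open>t\<close>, which have the
  moments \<open>E(t\<^sup>p cnj(t)\<^sup>q) = p!\<close> if \<open>p = q\<close> and \<open>0\<close> otherwise. The product takes each edge in
  its upward orientation.\<close>
definition wick :: "gmonom \<Rightarrow> nat" where
  "wick m = (if \<forall>i j. count m (i, j) = count m (j, i)
             then \<Prod>e\<in>{e\<in>set_mset m. fst e < snd e}. fact (count m e) else 0)"

definition gexp :: "gpoly \<Rightarrow> nat" where
  "gexp = lin_ext wick"

lemma wick_superset:
  assumes "finite S" "{e\<in>set_mset m. fst e < snd e} \<subseteq> S" "\<forall>i j. count m (i, j) = count m (j, i)"
  shows "wick m = (\<Prod>e\<in>S \<inter> {e. fst e < snd e}. fact (count m e))"
  using assms(3) unfolding wick_def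
  by (simp, intro prod.mono_neutral_left) (use assms(1,2) in \<open>auto, metis count_eq_zero_iff fact_0 One_nat_def\<close>)

lemma wick_add_edge:
  assumes "i \<noteq> j"
  shows "wick (add_mset (i, j) m) = count m (j, i) * wick (m - {#(j, i)#})"
proof (cases "(j, i) \<in># m")
  case True
  then obtain m' where m: "m = add_mset (j, i) m'" by (metis insert_DiffM)
  let ?M = "add_mset (i, j) m"
  have bal: "(\<forall>a b. count ?M (a, b) = count ?M (b, a)) \<longleftrightarrow> (\<forall>a b. count m' (a, b) = count m' (b, a))"
    using assms unfolding m by (auto simp: split: if_splits)
  show ?thesis
  proof (cases "\<forall>a b. count m' (a, b) = count m' (b, a)")
    case b: True
    define e where "e = (if i < j then (i, j) else (j, i))"
    have e: "e \<in> {e. fst e < snd e}" "fst e < snd e" using assms by (auto simp: e_def)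
    define S where "S = set_mset ?M"
    have fin: "finite S" by (simp add: S_def)
    have S: "S \<inter> {e. fst e < snd e} = insert e (S \<inter> {e. fst e < snd e} - {e})"
      using assms by (auto simp: S_def e_def m)
    have c1: "count ?M e = Suc (count m' e)" using assms by (auto simp: e_def m)
    have c2: "count ?M x = count m' x" if "x \<in> S \<inter> {e. fst e < snd e} - {e}" for x
      using that by (auto simp: e_def m split: if_splits)
    have "wick ?M = (\<Prod>e\<in>S \<inter> {e. fst e < snd e}. fact (count ?M e))"
      by (rule wick_superset) (use bal b in \<open>auto simp: S_def\<close>)
    also have "\<dots> = fact (Suc (count m' e)) * (\<Prod>e\<in>S \<inter> {e. fst e < snd e} - {e}. fact (count m' e))"
      by (subst S, subst prod.insert) (use fin c1 c2 in \<open>auto\<close>)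
    also have "\<dots> = Suc (count m' e) * (\<Prod>e\<in>S \<inter> {e. fst e < snd e}. fact (count m' e))"
      by (subst (2) S, subst prod.insert) (use fin in \<open>auto simp: algebra_simps\<close>)
    also have "(\<Prod>e\<in>S \<inter> {e. fst e < snd e}. fact (count m' e)) = wick m'"
      by (rule wick_superset[symmetric]) (use b in \<open>auto simp: S_def m\<close>)
    also have "count m' e = count m' (j, i)" using b by (auto simp: e_def)
    finally show ?thesis by (simp add: m)
  next
    case False
    then show ?thesis using bal by (auto simp: wick_def m)
  qed
next
  case False
  then have "count (add_mset (i, j) m) (i, j) \<noteq> count (add_mset (i, j) m) (j, i)"
    using assms by (simp add: not_in_iff)
  then have "wick (add_mset (i, j) m) = 0" unfolding wick_def by presburger
  then show ?thesis using False by (simp add: not_in_iff)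
qed

text \<open>Gaussian integration by parts. The variable paired with \<open>(i, j)\<close> is its conjugate \<open>(j, i)\<close>, and on
  monomials the identity is \<open>p! = p \<sqdot> (p - 1)!\<close>.\<close>
theorem gexp_gvar_mult:
  assumes "i \<noteq> j"
  shows "gexp (gvar i j * P) = gexp (gderiv j i P)"
proof (induction P rule: gpoly_induct)
  case (single m)
  show ?case by (simp add: gexp_def gvar_def mult_single gderiv_def wick_add_edge[OF assms])
qed (simp_all add: gexp_def distrib_left lin_ext_add gderiv_add)

lemma gexp_0 [simp]: "gexp 0 = 0"
  by (simp add: gexp_def)

lemma gexp_1 [simp]: "gexp 1 = 1"
  by (simp add: gexp_def wick_def flip: single_one)


section \<open>Closed walks and the removal of the least vertex\<close>

text \<open>A letter is a step of a walk. The order of the vertices is a parameter because reversing it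
  exchanges the two letters while all moments stay the same.\<close>
fun goes :: "(nat \<Rightarrow> nat \<Rightarrow> bool) \<Rightarrow> letter \<Rightarrow> nat \<Rightarrow> nat \<Rightarrow> bool" where
  "goes lt Plain i j = lt i j"
| "goes lt Star i j = lt j i"

definition step :: "(nat \<Rightarrow> nat \<Rightarrow> bool) \<Rightarrow> letter \<Rightarrow> nat \<Rightarrow> nat \<Rightarrow> gpoly" where
  "step lt c i j = (if goes lt c i j then gvar i j else 0)"

fun word_entry :: "(nat \<Rightarrow> nat \<Rightarrow> bool) \<Rightarrow> nat set \<Rightarrow> word \<Rightarrow> nat \<Rightarrow> nat \<Rightarrow> gpoly" where
  "word_entry lt V [] i j = (if i = j then 1 else 0)"
| "word_entry lt V (c # w) i j = (\<Sum>k\<in>V. step lt c i k * word_entry lt V w k j)"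

definition word_trace :: "(nat \<Rightarrow> nat \<Rightarrow> bool) \<Rightarrow> nat set \<Rightarrow> word \<Rightarrow> gpoly" where
  "word_trace lt V w = (\<Sum>i\<in>V. word_entry lt V w i i)"

lemma word_entry_append:
  assumes "finite V" "i \<in> V"
  shows "word_entry lt V (u @ w) i j = (\<Sum>k\<in>V. word_entry lt V u i k * word_entry lt V w k j)"
  using assms(2)
proof (induction u arbitrary: i)
  case Nil
  have "(\<Sum>k\<in>V. word_entry lt V [] i k * word_entry lt V w k j) =
    (\<Sum>k\<in>V. if i = k then word_entry lt V w k j else 0)"
    by (intro sum.cong) auto
  then show ?case using Nil assms by simp
next
  case (Cons c u)
  have "word_entry lt V ((c # u) @ w) i j =
    (\<Sum>k\<in>V. \<Sum>k'\<in>V. step lt c i k * (word_entry lt V u k k' * word_entry lt V w k' j))"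
    by (simp add: Cons.IH sum_distrib_left)
  also have "\<dots> = (\<Sum>k'\<in>V. \<Sum>k\<in>V. step lt c i k * (word_entry lt V u k k' * word_entry lt V w k' j))"
    by (rule sum.swap)
  finally show ?case by (simp add: sum_distrib_right mult.assoc)
qed

lemma gderiv_step: "b \<noteq> j \<Longrightarrow> gderiv a b (step lt c i j) = 0"
  by (simp add: step_def gderiv_gvar)

text \<open>The words of the smaller matrix do not contain the variables of the new vertex, so they are
  constants in the integration by parts with respect to its row.\<close>
lemma gderiv_word_entry: "a \<notin> V \<Longrightarrow> gderiv b a (word_entry lt V w i j) = 0"
proof (induction w arbitrary: i)
  case (Cons c w)
  have "gderiv b a (step lt c i k) = 0" if "k \<in> V" for k
    using that Cons.prems by (intro gderiv_step) auto
  then show ?case using Cons by (simp add: gderiv_sum gderiv_mult)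
qed simp

lemma gderiv_word_trace: "a \<notin> V \<Longrightarrow> gderiv b a (word_trace lt V w) = 0"
  by (simp add: word_trace_def gderiv_sum gderiv_word_entry)

fun splits_at :: "'a \<Rightarrow> 'a list \<Rightarrow> ('a list \<times> 'a list) list" where
  "splits_at c [] = []"
| "splits_at c (x # w) =
     (if x = c then [([], w)] else []) @ map (\<lambda>(u, v). (x # u, v)) (splits_at c w)"

lemma splits_at_append_eq: "(u, v) \<in> set (splits_at c w) \<Longrightarrow> w = u @ c # v"
  by (induction c w arbitrary: u v rule: splits_at.induct) (auto split: if_splits)

lemma splits_at_length: "p \<in> set (splits_at c w) \<Longrightarrow> length w = Suc (length (fst p) + length (snd p))"
  by (cases p) (auto dest: splits_at_append_eq)

text \<open>The ways in which a walk that spells the word can start and end at the least vertex, each given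
  by the words of its excursions. An excursion leaves by \<open>Plain\<close> and ends with the next return, by
  \<open>Star\<close>; both letters are dropped.\<close>
function (sequential) returns :: "word \<Rightarrow> word list list" where
  "returns [] = [[]]"
| "returns (Star # w) = []"
| "returns (Plain # w) =
     concat (map (\<lambda>p. map (\<lambda>us. fst p # us) (returns (snd p))) (splits_at Star w))"
  by pat_completeness auto
termination by (relation "Wellfounded.measure length") (auto dest: splits_at_length)

text \<open>The ways in which a closed walk can visit the least vertex at least once. Either it starts there,
  or the part of the word after the last exit and the part before the first arrival form, read
  cyclically, one further excursion; then the last exit is a \<open>Plain\<close>, the first arrival a \<open>Star\<close>.\<close>
definition visits :: "word \<Rightarrow> word list list" where
  "visits w = returns w @
     concat (map (\<lambda>p. concat (map (\<lambda>q. map (\<lambda>us. (snd p @ fst q) # us) (returns (snd q)))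
       (splits_at Star (fst p)))) (splits_at Plain w))"

fun merges :: "'a list \<Rightarrow> 'a list list \<Rightarrow> 'a list list list" where
  "merges u [] = []"
| "merges u (x # xs) = ((x @ u) # xs) # map ((#) x) (merges u xs)"

lemma length_merges: "us' \<in> set (merges u us) \<Longrightarrow> length us' = length us"
  by (induction us arbitrary: us') auto

text \<open>For a Gaussian row \<open>v\<close> this is the expectation of the product of the traces of \<open>ws\<close> and the forms
  \<open>v u v\<^sup>*\<close> with \<open>u\<close> in \<open>us\<close>, once \<open>f\<close> gives the expectations of products of traces: contracting the
  two vectors of one form closes \<open>u\<close> to a trace, and contracting across two forms \<open>v x v\<^sup>*\<close> and
  \<open>v u v\<^sup>*\<close> leaves the form of \<open>x u\<close>.\<close>
function contract :: "(word list \<Rightarrow> nat) \<Rightarrow> word list \<Rightarrow> word list \<Rightarrow> nat" where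
  "contract f ws [] = f ws"
| "contract f ws (u # us) =
     contract f (u # ws) us + (\<Sum>us'\<leftarrow>merges u us. contract f ws us')"
  by pat_completeness auto
termination by (relation "Wellfounded.measure (\<lambda>(f, ws, us). length us)") (auto dest: length_merges)

text \<open>Expands a product of traces over the larger matrix: every trace either stays within the smaller
  matrix or is replaced by one of its sets of visits. The first component collects the traces that
  stay, the second the excursions of the others.\<close>
fun expand :: "word list \<Rightarrow> (word list \<times> word list) list" where
  "expand [] = [([], [])]"
| "expand (w # ws) =
     map (\<lambda>p. (w # fst p, snd p)) (expand ws) @
     concat (map (\<lambda>us. map (\<lambda>p. (fst p, us @ snd p)) (expand ws)) (visits w))"

text \<open>The expectation of a product of traces of words in a strictly triangular matrix of size \<open>d\<close> with
  entries of variance 1. That it is this expectation is the content of \<open>gexp_word_trace\<close>.\<close>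
fun trace_moment :: "nat \<Rightarrow> word list \<Rightarrow> nat" where
  "trace_moment 0 ws = (if ws = [] then 1 else 0)"
| "trace_moment (Suc d) ws = (\<Sum>p\<leftarrow>expand ws. contract (trace_moment d) (fst p) (snd p))"

lemma sum_list_concat_map: "(\<Sum>x\<leftarrow>concat (map f xs). g x) = (\<Sum>y\<leftarrow>xs. \<Sum>x\<leftarrow>f y. g x)"
  by (induction xs) auto

lemma sum_sum_list_swap: "(\<Sum>k\<in>A. \<Sum>x\<leftarrow>xs. f k x) = (\<Sum>x\<leftarrow>xs. \<Sum>k\<in>A. f k x)"
  by (induction xs) (auto simp: sum.distrib)

locale new_minimum =
  fixes lt :: "nat \<Rightarrow> nat \<Rightarrow> bool" and V :: "nat set" and a :: nat
  assumes finite_V: "finite V" and a_notin: "a \<notin> V"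
    and a_min: "b \<in> V \<Longrightarrow> lt a b" and not_below: "b \<in> V \<Longrightarrow> \<not> lt b a" and irrefl_a: "\<not> lt a a"
begin

abbreviation "W \<equiv> insert a V"

text \<open>For the row \<open>v\<close> of the new vertex, the next three are the vectors \<open>v u\<close> and \<open>u v\<^sup>*\<close> and the form
  \<open>v u v\<^sup>*\<close>.\<close>
definition row :: "word \<Rightarrow> nat \<Rightarrow> gpoly" where
  "row u j = (\<Sum>d\<in>V. gvar a d * word_entry lt V u d j)"

definition col :: "word \<Rightarrow> nat \<Rightarrow> gpoly" where
  "col u i = (\<Sum>c\<in>V. word_entry lt V u i c * gvar c a)"

definition quad :: "word \<Rightarrow> gpoly" where
  "quad u = (\<Sum>b\<in>V. \<Sum>c\<in>V. gvar a b * word_entry lt V u b c * gvar c a)"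

lemma quad_col: "quad u = (\<Sum>b\<in>V. gvar a b * col u b)"
  by (simp add: quad_def col_def sum_distrib_left mult.assoc)

lemma sum_row_col: "(\<Sum>i\<in>V. row b i * col u i) = quad (b @ u)"
proof -
  have "quad (b @ u) = (\<Sum>d\<in>V. \<Sum>c\<in>V. \<Sum>i\<in>V. gvar a d * (word_entry lt V b d i * word_entry lt V u i c) * gvar c a)"
    unfolding quad_def by (intro sum.cong refl) (simp add: word_entry_append finite_V sum_distrib_left sum_distrib_right)
  also have "\<dots> = (\<Sum>d\<in>V. \<Sum>i\<in>V. \<Sum>c\<in>V. gvar a d * (word_entry lt V b d i * word_entry lt V u i c) * gvar c a)"
    by (intro sum.cong refl sum.swap)
  also have "\<dots> = (\<Sum>i\<in>V. \<Sum>d\<in>V. \<Sum>c\<in>V. gvar a d * (word_entry lt V b d i * word_entry lt V u i c) * gvar c a)"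
    by (rule sum.swap)
  also have "\<dots> = (\<Sum>i\<in>V. row b i * col u i)"
    unfolding row_def col_def by (simp add: sum_product mult.assoc)
  finally show ?thesis by simp
qed

lemma sum_W: "(\<Sum>k\<in>W. f k) = f a + (\<Sum>k\<in>V. f k)"
  using finite_V a_notin by simp

lemma step_from_a: "j \<in> V \<Longrightarrow> step lt Plain a j = gvar a j" "j \<in> V \<Longrightarrow> step lt Star a j = 0"
  and step_to_a: "i \<in> V \<Longrightarrow> step lt Star i a = gvar i a" "i \<in> V \<Longrightarrow> step lt Plain i a = 0"
  and step_a_a: "step lt c a a = 0"
  using a_min not_below irrefl_a by (cases c; simp add: step_def)+

text \<open>The walk splits at its first arrival at \<open>a\<close>. Nothing lies below \<open>a\<close>, so this step is a \<open>Star\<close>.\<close>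
lemma word_entry_first_hit:
  assumes "k \<in> V"
  shows "word_entry lt W w k a =
    (\<Sum>p\<leftarrow>splits_at Star w. col (fst p) k * word_entry lt W (snd p) a a)"
  using assms
proof (induction w arbitrary: k)
  case Nil
  then show ?case using a_notin by auto
next
  case (Cons c w)
  have col_Nil: "col [] k = gvar k a"
  proof -
    have "col [] k = (\<Sum>c\<in>V. if k = c then gvar c a else 0)"
      unfolding col_def by (intro sum.cong) auto
    then show ?thesis using finite_V Cons.prems by simp
  qed
  have col_Cons: "col (c # u) k = (\<Sum>k'\<in>V. step lt c k k' * col u k')" for u
  proof -
    have "col (c # u) k = (\<Sum>c'\<in>V. \<Sum>k'\<in>V. step lt c k k' * (word_entry lt V u k' c' * gvar c' a))"
      by (simp add: col_def sum_distrib_right mult.assoc)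
    also have "\<dots> = (\<Sum>k'\<in>V. \<Sum>c'\<in>V. step lt c k k' * (word_entry lt V u k' c' * gvar c' a))"
      by (rule sum.swap)
    finally show ?thesis by (simp add: col_def sum_distrib_left)
  qed
  have "word_entry lt W (c # w) k a = step lt c k a * word_entry lt W w a a +
      (\<Sum>k'\<in>V. step lt c k k' * word_entry lt W w k' a)"
    by (simp add: sum_W)
  also have "(\<Sum>k'\<in>V. step lt c k k' * word_entry lt W w k' a) =
     (\<Sum>k'\<in>V. step lt c k k' * (\<Sum>p\<leftarrow>splits_at Star w. col (fst p) k' * word_entry lt W (snd p) a a))"
    using Cons.IH by simp
  also have "\<dots> = (\<Sum>p\<leftarrow>splits_at Star w. col (c # fst p) k * word_entry lt W (snd p) a a)"
    by (simp add: sum_list_const_mult[symmetric] sum_sum_list_swap col_Cons sum_distrib_right mult.assoc)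
  finally show ?case
    using Cons.prems step_to_a
    by (cases c) (simp_all add: o_def case_prod_beta col_Nil)
qed


lemma word_entry_returns: "word_entry lt W w a a = (\<Sum>us\<leftarrow>returns w. \<Prod>u\<leftarrow>us. quad u)"
proof (induction w rule: returns.induct)
  case (2 w)
  then show ?case by (simp add: sum_W step_a_a step_from_a)
next
  case (3 w)
  have "word_entry lt W (Plain # w) a a = (\<Sum>k\<in>V. gvar a k * word_entry lt W w k a)"
    by (simp add: sum_W step_a_a step_from_a)
  also have "\<dots> = (\<Sum>k\<in>V. gvar a k *
      (\<Sum>p\<leftarrow>splits_at Star w. col (fst p) k * word_entry lt W (snd p) a a))"
    using word_entry_first_hit by simp
  also have "\<dots> = (\<Sum>p\<leftarrow>splits_at Star w. quad (fst p) * word_entry lt W (snd p) a a)"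
    by (simp add: sum_list_const_mult[symmetric] sum_sum_list_swap quad_col sum_distrib_right mult.assoc)
  also have "\<dots> = (\<Sum>p\<leftarrow>splits_at Star w. quad (fst p) * (\<Sum>us\<leftarrow>returns (snd p). \<Prod>u\<leftarrow>us. quad u))"
    using 3 by (intro arg_cong[where f = sum_list] map_cong) auto
  also have "\<dots> = (\<Sum>us\<leftarrow>returns (Plain # w). \<Prod>u\<leftarrow>us. quad u)"
    by (simp add: sum_list_concat_map o_def sum_list_const_mult)
  finally show ?case .
qed auto

text \<open>The walk either avoids \<open>a\<close> or splits at its last exit from \<open>a\<close>, which is a \<open>Plain\<close>.\<close>
lemma word_entry_last_exit:
  assumes "j \<in> V" "i \<in> W"
  shows "word_entry lt W w i j = (if i = a then 0 else word_entry lt V w i j) +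
    (\<Sum>p\<leftarrow>splits_at Plain w. word_entry lt W (fst p) i a * row (snd p) j)"
  using assms(2)
proof (induction w arbitrary: i)
  case Nil
  then show ?case using assms(1) a_notin by auto
next
  case (Cons c w)
  have "word_entry lt W (c # w) i j =
     (\<Sum>k\<in>W. step lt c i k * ((if k = a then 0 else word_entry lt V w k j) +
        (\<Sum>p\<leftarrow>splits_at Plain w. word_entry lt W (fst p) k a * row (snd p) j)))"
    using Cons.IH by (simp del: sum.insert)
  also have "\<dots> = (\<Sum>k\<in>W. step lt c i k * (if k = a then 0 else word_entry lt V w k j)) +
      (\<Sum>p\<leftarrow>splits_at Plain w. word_entry lt W (c # fst p) i a * row (snd p) j)"
    by (simp add: distrib_left sum.distrib sum_list_const_mult[symmetric] sum_sum_list_swap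
        sum_distrib_right mult.assoc del: sum.insert)
  also have "(\<Sum>k\<in>W. step lt c i k * (if k = a then 0 else word_entry lt V w k j)) =
      (\<Sum>k\<in>V. step lt c i k * word_entry lt V w k j)"
    using a_notin by (auto simp: sum_W intro!: sum.cong)
  also have "\<dots> = (if i = a then 0 else word_entry lt V (c # w) i j) +
      (if c = Plain then word_entry lt W [] i a * row w j else 0)"
    by (cases c) (auto simp: row_def step_from_a)
  finally show ?case
    by (simp add: o_def case_prod_beta add.assoc del: word_entry.simps)
qed

text \<open>Split at the last exit from \<open>a\<close>, then at the first arrival. In the trace the sum over the starting
  vertex joins the two outer pieces of the walk to a single form.\<close>
lemma word_trace_visits:
  "word_trace lt W w = word_trace lt V w + (\<Sum>us\<leftarrow>visits w. \<Prod>u\<leftarrow>us. quad u)"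
proof -
  have "(\<Sum>i\<in>V. word_entry lt W w i i) = (\<Sum>i\<in>V. word_entry lt V w i i +
      (\<Sum>p\<leftarrow>splits_at Plain w. (\<Sum>q\<leftarrow>splits_at Star (fst p).
          col (fst q) i * word_entry lt W (snd q) a a) * row (snd p) i))"
    using a_notin by (intro sum.cong refl, subst word_entry_last_exit) (auto simp: word_entry_first_hit)
  also have "\<dots> = word_trace lt V w + (\<Sum>p\<leftarrow>splits_at Plain w. \<Sum>q\<leftarrow>splits_at Star (fst p).
          quad (snd p @ fst q) * word_entry lt W (snd q) a a)"
    by (simp add: word_trace_def sum.distrib sum_list_mult_const[symmetric] sum_sum_list_swap
        sum_row_col[symmetric]) (simp add: sum_distrib_left sum_distrib_right mult_ac)
  finally show ?thesis
    by (simp add: word_trace_def[of lt W] sum_W visits_def word_entry_returns sum_list_concat_map o_def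
        sum_list_const_mult add_ac)
qed

lemma prod_trace_expand:
  "(\<Prod>w\<leftarrow>ws. word_trace lt W w) =
   (\<Sum>p\<leftarrow>expand ws. (\<Prod>w\<leftarrow>fst p. word_trace lt V w) * (\<Prod>u\<leftarrow>snd p. quad u))"
proof (induction ws)
  case (Cons w ws)
  then show ?case
    by (simp add: word_trace_visits distrib_right o_def sum_list_concat_map mult.assoc
        sum_list_const_mult sum_list_mult_const[symmetric]) (simp add: sum_list_const_mult[symmetric] mult_ac)
qed simp

text \<open>The form contains one conjugated entry of the row; differentiating removes it and leaves \<open>v u\<close>.\<close>
lemma gderiv_quad:
  assumes "b \<in> V"
  shows "gderiv b a (quad u) = row u b"
proof -
  have "b \<noteq> a" using assms a_notin by auto
  then have "gderiv b a (quad u) = (\<Sum>d\<in>V. \<Sum>c\<in>V. if b = c then gvar a d * word_entry lt V u d c else 0)"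
    unfolding quad_def using assms a_notin
    by (auto simp: gderiv_sum gderiv_mult gderiv_gvar gderiv_word_entry intro!: sum.cong)
  also have "\<dots> = row u b"
    using assms finite_V by (simp add: row_def)
  finally show ?thesis .
qed

text \<open>By the Leibniz rule the derivative hits one form \<open>v x v\<^sup>*\<close> at a time and leaves \<open>v x\<close>, whose product
  with \<open>u v\<^sup>*\<close> is the form of \<open>x u\<close>.\<close>
lemma merges_quad:
  "(\<Sum>b\<in>V. col u b * gderiv b a (\<Prod>x\<leftarrow>us. quad x)) = (\<Sum>us'\<leftarrow>merges u us. \<Prod>x\<leftarrow>us'. quad x)"
proof (induction us)
  case (Cons x us)
  have "(\<Sum>b\<in>V. col u b * gderiv b a (\<Prod>x\<leftarrow>x # us. quad x)) =
    (\<Sum>b\<in>V. row x b * col u b * (\<Prod>x\<leftarrow>us. quad x) +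
       quad x * (col u b * gderiv b a (\<Prod>x\<leftarrow>us. quad x)))"
    by (intro sum.cong refl) (simp add: gderiv_mult gderiv_quad algebra_simps)
  also have "\<dots> = quad (x @ u) * (\<Prod>x\<leftarrow>us. quad x) +
       quad x * (\<Sum>b\<in>V. col u b * gderiv b a (\<Prod>x\<leftarrow>us. quad x))"
    by (simp add: sum.distrib sum_row_col flip: sum_distrib_left sum_distrib_right)
  finally show ?case using Cons by (simp add: o_def sum_list_const_mult)
qed simp

text \<open>Integration by parts in the entries of the row: the derivative hits either the conjugated row of
  the same form, which gives the trace, or the remaining factor.\<close>
lemma gexp_quad_mult:
  "gexp (quad u * F) = gexp (word_trace lt V u * F) + gexp (\<Sum>b\<in>V. col u b * gderiv b a F)"
proof -
  have "gexp (quad u * F) = (\<Sum>b\<in>V. gexp (gvar a b * (col u b * F)))"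
    by (simp add: quad_col sum_distrib_right mult.assoc gexp_def lin_ext_sum)
  also have "\<dots> = (\<Sum>b\<in>V. gexp (word_entry lt V u b b * F + col u b * gderiv b a F))"
  proof (intro sum.cong refl)
    fix b assume b: "b \<in> V"
    have "gderiv b a (col u b) = (\<Sum>c\<in>V. if b = c then word_entry lt V u b c else 0)"
      unfolding col_def using a_notin
      by (auto simp: gderiv_sum gderiv_mult gderiv_gvar gderiv_word_entry intro!: sum.cong)
    then have "gderiv b a (col u b) = word_entry lt V u b b"
      using b finite_V by simp
    moreover have "a \<noteq> b" using b a_notin by auto
    ultimately show "gexp (gvar a b * (col u b * F)) = gexp (word_entry lt V u b b * F + col u b * gderiv b a F)"
      by (simp add: gexp_gvar_mult gderiv_mult)
  qed
  finally show ?thesis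
    by (simp add: gexp_def lin_ext_sum[symmetric] lin_ext_add sum.distrib word_trace_def sum_distrib_right)
qed

lemma gderiv_prod_trace: "gderiv b a (\<Prod>w\<leftarrow>ws. word_trace lt V w) = 0"
  by (induction ws) (simp_all add: gderiv_mult gderiv_word_trace a_notin)

lemma gexp_contract:
  "gexp ((\<Prod>w\<leftarrow>ws. word_trace lt V w) * (\<Prod>u\<leftarrow>us. quad u)) =
   contract (\<lambda>ws. gexp (\<Prod>w\<leftarrow>ws. word_trace lt V w)) ws us"
proof (induction "\<lambda>ws. gexp (\<Prod>w\<leftarrow>ws. word_trace lt V w)" ws us rule: contract.induct)
  case (2 ws u us)
  let ?F = "(\<Prod>w\<leftarrow>ws. word_trace lt V w) * (\<Prod>u\<leftarrow>us. quad u)"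
  have "(\<Sum>b\<in>V. col u b * gderiv b a ?F) =
    (\<Prod>w\<leftarrow>ws. word_trace lt V w) * (\<Sum>b\<in>V. col u b * gderiv b a (\<Prod>u\<leftarrow>us. quad u))"
    by (simp add: gderiv_mult gderiv_prod_trace sum_distrib_left mult_ac)
  also have "\<dots> = (\<Sum>us'\<leftarrow>merges u us. (\<Prod>w\<leftarrow>ws. word_trace lt V w) * (\<Prod>x\<leftarrow>us'. quad x))"
    by (simp add: merges_quad sum_list_const_mult)
  finally have "gexp (\<Sum>b\<in>V. col u b * gderiv b a ?F) =
    (\<Sum>us'\<leftarrow>merges u us. gexp ((\<Prod>w\<leftarrow>ws. word_trace lt V w) * (\<Prod>x\<leftarrow>us'. quad x)))"
    by (simp add: gexp_def lin_ext_sum_list)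
  also have "\<dots> = (\<Sum>us'\<leftarrow>merges u us. contract (\<lambda>ws. gexp (\<Prod>w\<leftarrow>ws. word_trace lt V w)) ws us')"
    using 2(2) by (intro arg_cong[where f = sum_list] map_cong) auto
  finally show ?case
    using gexp_quad_mult[of u ?F] 2(1) by (simp add: mult_ac)
qed simp

end

text \<open>Removing the least vertex again and again shows that the expectation depends on the order only
  through the existence of least elements, and on the vertex set only through its size.\<close>
theorem gexp_word_trace:
  assumes least: "\<And>V. finite V \<Longrightarrow> V \<noteq> {} \<Longrightarrow> \<exists>a\<in>V. \<forall>b\<in>V. b \<noteq> a \<longrightarrow> lt a b \<and> \<not> lt b a"
    and irrefl: "\<And>a. \<not> lt a a" and "finite V"
  shows "gexp (\<Prod>w\<leftarrow>ws. word_trace lt V w) = trace_moment (card V) ws"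
  using \<open>finite V\<close>
proof (induction "card V" arbitrary: V ws)
  case 0
  then have "word_trace lt V w = 0" for w by (simp add: word_trace_def)
  then show ?case using 0 by (cases ws) simp_all
next
  case (Suc d)
  then have "V \<noteq> {}" by auto
  then obtain a where a: "a \<in> V" "\<And>b. b \<in> V \<Longrightarrow> b \<noteq> a \<Longrightarrow> lt a b \<and> \<not> lt b a"
    using least[OF Suc.prems] by blast
  define V' where "V' = V - {a}"
  have V: "V = insert a V'" and card: "card V' = d" and fin: "finite V'"
    using a Suc by (auto simp: V'_def)
  interpret new_minimum lt V' a
    by standard (use a irrefl fin in \<open>auto simp: V'_def\<close>)
  have IH: "(\<lambda>ws. gexp (\<Prod>w\<leftarrow>ws. word_trace lt V' w)) = trace_moment d"
    using Suc.hyps(1)[of V'] card fin by auto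
  show ?case
    unfolding V prod_trace_expand gexp_def lin_ext_sum_list
    unfolding gexp_def[symmetric] gexp_contract IH
    by (simp add: card fin a_notin)
qed

lemma trace_moment_less: "gexp (\<Prod>w\<leftarrow>ws. word_trace (<) {..<d} w) = trace_moment d ws"
proof -
  have "\<exists>a\<in>V. \<forall>b\<in>V. b \<noteq> a \<longrightarrow> a < b \<and> \<not> b < a" if "finite V" "V \<noteq> {}" for V :: "nat set"
    using that by (intro bexI[of _ "Min V"] ballI impI) (metis Min_le le_neq_implies_less less_asym, simp)
  from gexp_word_trace[of "(<)", OF this, of "{..<d}"] show ?thesis by simp
qed

lemma trace_moment_greater: "gexp (\<Prod>w\<leftarrow>ws. word_trace (>) {..<d} w) = trace_moment d ws"
proof -
  have "\<exists>a\<in>V. \<forall>b\<in>V. b \<noteq> a \<longrightarrow> a > b \<and> \<not> b > a" if "finite V" "V \<noteq> {}" for V :: "nat set"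
    using that by (intro bexI[of _ "Max V"] ballI impI) (metis Max_ge le_neq_implies_less less_asym, simp)
  from gexp_word_trace[of "(>)", OF this, of "{..<d}"] show ?thesis by simp
qed

fun flip :: "letter \<Rightarrow> letter" where
  "flip Star = Plain"
| "flip Plain = Star"

lemma word_entry_flip: "word_entry (<) V (map flip w) i j = word_entry (>) V w i j"
proof (induction w arbitrary: i)
  case (Cons c w)
  have "step (<) (flip c) i k = step (>) c i k" for k
    by (cases c) (simp_all add: step_def)
  then show ?case using Cons by simp
qed simp

text \<open>The same numbers belong to the order \<open><\<close> and to its reversal, and reversal exchanges the two letters.\<close>
theorem trace_moment_flip: "trace_moment d (map (map flip) ws) = trace_moment d ws"
proof -
  have "trace_moment d (map (map flip) ws) = gexp (\<Prod>w\<leftarrow>ws. word_trace (>) {..<d} w)"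
    by (simp flip: trace_moment_less add: word_trace_def word_entry_flip o_def)
  then show ?thesis by (simp only: trace_moment_greater)
qed

lemma word_trace_commute:
  assumes "finite V" shows "word_trace lt V (u @ v) = word_trace lt V (v @ u)"
proof -
  have "word_trace lt V (u @ v) = (\<Sum>i\<in>V. \<Sum>k\<in>V. word_entry lt V u i k * word_entry lt V v k i)"
    unfolding word_trace_def by (intro sum.cong refl word_entry_append assms)
  also have "\<dots> = (\<Sum>k\<in>V. \<Sum>i\<in>V. word_entry lt V u i k * word_entry lt V v k i)"
    by (rule sum.swap)
  also have "\<dots> = word_trace lt V (v @ u)"
    unfolding word_trace_def
    by (rule sum.cong[OF refl], subst word_entry_append[OF assms]) (simp_all add: mult.commute)
  finally show ?thesis .
qed

lemma trace_moment_rotate: "trace_moment d [u @ v] = trace_moment d [v @ u]"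
  using trace_moment_less[of d "[u @ v]"] trace_moment_less[of d "[v @ u]"]
    word_trace_commute[of "{..<d}" "(<)" u v] by simp


section \<open>Moments of complex Gaussian variables\<close>

abbreviation centred_normal :: "real \<Rightarrow> real measure" where
  "centred_normal s \<equiv> density lborel (\<lambda>x. ennreal (normal_density 0 s x))"

lemma integrable_centred_normal:
  assumes "s > 0" shows "integrable (centred_normal s) (\<lambda>x. x ^ k)"
  using integrable_normal_moment[OF assms, of 0 k] by (simp add: integrable_density)

definition normal_moment :: "real \<Rightarrow> nat \<Rightarrow> real" where
  "normal_moment s k = (\<integral>x. x ^ k \<partial>centred_normal s)"

lemma normal_moment_even_value:
  assumes "s > 0" shows "normal_moment s (2 * k) = fact (2 * k) / ((2 / s\<^sup>2) ^ k * fact k)"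
  using has_bochner_integral_integral_eq[OF normal_moment_even[OF assms, of 0 k]]
  by (simp add: normal_moment_def integral_density)

lemma normal_moment_odd_value:
  assumes "s > 0" shows "normal_moment s (Suc (2 * k)) = 0"
  using has_bochner_integral_integral_eq[OF normal_moment_odd[OF assms, of 0 k]]
  by (simp add: normal_moment_def integral_density)

text \<open>Stein's identity on powers.\<close>
lemma normal_moment_Suc:
  assumes s: "s > 0"
  shows "normal_moment s (Suc k) = s\<^sup>2 * real k * normal_moment s (k - 1)"
proof (cases "even k")
  case True
  then obtain m where k: "k = 2 * m" by auto
  show ?thesis
  proof (cases m)
    case (Suc m')
    then have "k - 1 = Suc (2 * m')" by (simp add: k)
    then show ?thesis using s k by (simp add: normal_moment_odd_value)
  qed (use s k normal_moment_odd_value[of s 0] in simp)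
next
  case False
  then obtain m where k: "k = Suc (2 * m)" by (auto elim: oddE)
  have "Suc k = 2 * Suc m" "k - 1 = 2 * m" by (simp_all add: k)
  then have "normal_moment s (Suc k) = fact (2 * Suc m) / ((2 / s\<^sup>2) ^ Suc m * fact (Suc m))"
     "normal_moment s (k - 1) = fact (2 * m) / ((2 / s\<^sup>2) ^ m * fact m)"
    using normal_moment_even_value[OF s] by metis+
  moreover have "fact (2 * Suc m) = (2 * real m + 2) * real k * fact (2 * m)"
    by (simp add: k algebra_simps)
  moreover define A where "A = (2 / s\<^sup>2) ^ m * (fact m :: real)"
  moreover have "(2 / s\<^sup>2) ^ Suc m * (fact (Suc m) :: real) = 2 / s\<^sup>2 * (real m + 1) * A"
    by (simp add: A_def algebra_simps)
  moreover have "A > 0" using s by (simp add: A_def)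
  ultimately have nm: "normal_moment s (Suc k) = (2 * real m + 2) * real k * fact (2 * m) / (2 / s\<^sup>2 * (real m + 1) * A)"
    "normal_moment s (k - 1) = fact (2 * m) / A" by (simp_all only:)
  show ?thesis unfolding nm using s \<open>A > 0\<close> by (simp add: divide_simps)
qed

text \<open>Read \<open>M a b p q\<close> as \<open>E(x\<^sup>a y\<^sup>b z\<^sup>p cnj(z)\<^sup>q)\<close> with \<open>z = x + \<i>y\<close>, where \<open>x\<close> and \<open>y\<close> are independent centred
  Gaussians of variance \<open>c\<close>. Stein's identities for \<open>x\<close> and \<open>y\<close> extend from monomials in \<open>x, y\<close> to all
  these monomials. In \<open>E(z F) = E(x F) + \<i> E(y F)\<close> the derivatives in \<open>z\<close> cancel and those in \<open>cnj z\<close>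
  add up, which gives the recursion of the complex Gaussian moments.\<close>
lemma gaussian_moment_algebra:
  fixes M :: "nat \<Rightarrow> nat \<Rightarrow> nat \<Rightarrow> nat \<Rightarrow> complex" and c :: complex
  assumes z: "\<And>a b p q. M a b (Suc p) q = M (Suc a) b p q + \<i> * M a (Suc b) p q"
    and z': "\<And>a b p q. M a b p (Suc q) = M (Suc a) b p q - \<i> * M a (Suc b) p q"
    and x: "\<And>a b. M (Suc a) b 0 0 = c * of_nat a * M (a - 1) b 0 0"
    and y: "\<And>a b. M a (Suc b) 0 0 = c * of_nat b * M a (b - 1) 0 0"
    and one: "M 0 0 0 0 = 1"
  shows "M 0 0 p q = (if p = q then fact p * (2 * c) ^ p else 0)"
proof -
  have za: "of_nat a * M (a - 1) b (Suc p) q = of_nat a * (M a b p q + \<i> * M (a - 1) (Suc b) p q)"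
   and zb: "of_nat b * M a (b - 1) (Suc p) q = of_nat b * (M (Suc a) (b - 1) p q + \<i> * M a b p q)"
   and zp: "of_nat p * M a b p q = of_nat p * (M (Suc a) b (p - 1) q + \<i> * M a (Suc b) (p - 1) q)"
   and z'a: "of_nat a * M (a - 1) b p (Suc q) = of_nat a * (M a b p q - \<i> * M (a - 1) (Suc b) p q)"
   and z'b: "of_nat b * M a (b - 1) p (Suc q) = of_nat b * (M (Suc a) (b - 1) p q - \<i> * M a b p q)"
   and z'q: "of_nat q * M a b p q = of_nat q * (M (Suc a) b p (q - 1) - \<i> * M a (Suc b) p (q - 1))"
   for a b p q
    by (cases a, simp, simp add: z) (cases b, simp, simp add: z, cases p, simp, simp add: z,
        cases a, simp, simp add: z', cases b, simp, simp add: z', cases q, simp, simp add: z')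
  have zq: "of_nat q * M a b (Suc p) (q - 1) = of_nat q * (M (Suc a) b p (q - 1) + \<i> * M a (Suc b) p (q - 1))" for a b p q
    by (simp add: z)
  have z'p: "of_nat p * M a b (p - 1) (Suc q) = of_nat p * (M (Suc a) b (p - 1) q - \<i> * M a (Suc b) (p - 1) q)" for a b p q
    by (simp add: z')
  have Suc_split: "of_nat (Suc n) * (t :: complex) = t + of_nat n * t" for n t
    by (simp add: algebra_simps)
  have XY: "(\<forall>a b. M (Suc a) b p q = c * (of_nat a * M (a - 1) b p q + of_nat p * M a b (p - 1) q
              + of_nat q * M a b p (q - 1))) \<and>
        (\<forall>a b. M a (Suc b) p q = c * (of_nat b * M a (b - 1) p q + \<i> * (of_nat p * M a b (p - 1) q)
              - \<i> * (of_nat q * M a b p (q - 1))))" (is "(\<forall>a b. ?X a b p q) \<and> (\<forall>a b. ?Y a b p q)") for p q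
  proof (induction p)
    case 0
    show ?case
    proof (induction q)
      case 0
      show ?case using x y by simp
    next
      case (Suc q)
      then have X: "?X a b 0 q" and Y: "?Y a b 0 q" for a b by blast+
      have "?X a b 0 (Suc q)" for a b
        unfolding z'[of "Suc a"] X[of "Suc a" b] X[of a "Suc b"] diff_Suc_1 z'a Suc_split z'q[of q a b 0]
        by (simp only: of_nat_0 mult_zero_left add_0_left add_0_right) (simp add: algebra_simps)
      moreover have "?Y a b 0 (Suc q)" for a b
        unfolding z'[of a "Suc b"] Y[of "Suc a" b] Y[of a "Suc b"] diff_Suc_1 z'b Suc_split z'q[of q a b 0]
        by (simp only: of_nat_0 mult_zero_left mult_zero_right add_0_left add_0_right diff_0) (simp add: algebra_simps)
      ultimately show ?case by blast
    qed
  next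
    case (Suc p)
    then have X: "?X a b p q" and Y: "?Y a b p q" for a b by blast+
    have "?X a b (Suc p) q" for a b
      unfolding z[of "Suc a"] X[of "Suc a" b] X[of a "Suc b"] diff_Suc_1 za zq Suc_split zp[of p a b q]
      by (simp add: algebra_simps)
    moreover have "?Y a b (Suc p) q" for a b
      unfolding z[of a "Suc b"] Y[of "Suc a" b] Y[of a "Suc b"] diff_Suc_1 zb zq Suc_split zp[of p a b q]
      by (simp add: algebra_simps)
    ultimately show ?case by blast
  qed
  have X: "M (Suc a) b p q = c * (of_nat a * M (a - 1) b p q + of_nat p * M a b (p - 1) q
              + of_nat q * M a b p (q - 1))" 
   and Y: "M a (Suc b) p q = c * (of_nat b * M a (b - 1) p q + \<i> * (of_nat p * M a b (p - 1) q)
              - \<i> * (of_nat q * M a b p (q - 1)))" for a b p q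
    using XY[of p q] by blast+
  \<comment> \<open>in both combinations \<open>x \<plusminus> \<i>y\<close> one of the two kinds of derivatives cancels\<close>
  have wick_left: "M 0 0 (Suc p) q = 2 * c * of_nat q * M 0 0 p (q - 1)" for p q
    unfolding z X[of 0 0] Y[of 0 0] of_nat_0 by (simp add: algebra_simps)
  have vanish: "M 0 0 0 (Suc q) = 0" for q
    unfolding z' X[of 0 0] Y[of 0 0] of_nat_0 by (simp add: algebra_simps)
  show ?thesis
  proof (induction p arbitrary: q)
    case 0
    show ?case using vanish one by (cases q) simp_all
  next
    case (Suc p)
    show ?case using wick_left Suc by (cases q) (simp_all add: algebra_simps)
  qed
qed

text \<open>Both statements come from monomials in the real and imaginary part: these are integrable by
  Fubini, and multiplying by \<open>z\<close> or \<open>cnj z\<close> stays within their span.\<close>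
lemma complex_gaussian_moment:
  assumes v: "v > 0"
  shows "integrable (complex_gaussian v) (\<lambda>z. z ^ p * cnj z ^ q)"
    and "(\<integral>z. z ^ p * cnj z ^ q \<partial>complex_gaussian v) = (if p = q then fact p * of_real v ^ p else 0)"
proof -
  define s where "s = sqrt (v / 2)"
  have s: "s > 0" "2 * s\<^sup>2 = v" using v by (simp_all add: s_def)
  define N where "N = centred_normal s"
  interpret N: prob_space N unfolding N_def by (rule prob_space_normal_density[OF s(1)])
  interpret P: pair_prob_space N N ..
  have [measurable_cong]: "sets N = sets borel" by (simp add: N_def)
  define f where "f a b p q = (\<lambda>(x, y). complex_of_real x ^ a * complex_of_real y ^ b * Complex x y ^ p * cnj (Complex x y) ^ q)"
    for a b p q
  have f_Suc: "f a b (Suc p) q = (\<lambda>z. f (Suc a) b p q z + \<i> * f a (Suc b) p q z)"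
     "f a b p (Suc q) = (\<lambda>z. f (Suc a) b p q z - \<i> * f a (Suc b) p q z)" for a b p q
    by (auto simp: f_def fun_eq_iff Complex_eq algebra_simps)
  have moment: "integrable N (\<lambda>x. complex_of_real x ^ k)"
    "(\<integral>x. complex_of_real x ^ k \<partial>N) = of_real (normal_moment s k)" for k
  proof -
    have *: "integrable N (\<lambda>x. x ^ k :: real)" unfolding N_def by (rule integrable_centred_normal[OF s(1)])
    have "integrable N (\<lambda>x. complex_of_real (x ^ k))" using * by (rule integrable_of_real)
    then show "integrable N (\<lambda>x. complex_of_real x ^ k)" by (subst (asm) of_real_power)
    have "(\<integral>x. complex_of_real (x ^ k) \<partial>N) = of_real (\<integral>x. x ^ k \<partial>N)" using * by (rule integral_of_real)
    then show "(\<integral>x. complex_of_real x ^ k \<partial>N) = of_real (normal_moment s k)"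
      by (simp add: normal_moment_def N_def)
  qed
  have base: "integrable (N \<Otimes>\<^sub>M N) (f a b 0 0)" for a b
  proof (rule P.Fubini_integrable)
    show "f a b 0 0 \<in> borel_measurable (N \<Otimes>\<^sub>M N)" unfolding f_def power_0 mult_1_right by measurable
    have "integrable N (\<lambda>x. norm (complex_of_real x ^ a) * (\<integral>y. norm (complex_of_real y ^ b) \<partial>N))"
      using moment(1)[of a] by (intro integrable_mult_left integrable_norm)
    then show "integrable N (\<lambda>x. \<integral>y. norm (f a b 0 0 (x, y)) \<partial>N)"
      by (simp add: f_def norm_mult)
    show "AE x in N. integrable N (\<lambda>y. f a b 0 0 (x, y))"
      using moment(1)[of b] by (simp add: f_def)
  qed
  have int: "integrable (N \<Otimes>\<^sub>M N) (f a b p q)" for a b p q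
  proof (induction p arbitrary: a b)
    case 0
    show ?case
    proof (induction q arbitrary: a b)
      case (Suc q)
      then show ?case unfolding f_Suc by (intro Bochner_Integration.integrable_diff integrable_mult_right)
    qed (rule base)
  next
    case (Suc p)
    then show ?case unfolding f_Suc by (intro Bochner_Integration.integrable_add integrable_mult_right)
  qed
  define M where "M a b p q = (\<integral>z. f a b p q z \<partial>(N \<Otimes>\<^sub>M N))" for a b p q
  have M00: "M a b 0 0 = of_real (normal_moment s a * normal_moment s b)" for a b
  proof -
    have "M a b 0 0 = (\<integral>x. (\<integral>y. f a b 0 0 (x, y) \<partial>N) \<partial>N)"
      unfolding M_def by (rule P.integral_fst'[symmetric]) (rule base)
    then show ?thesis by (simp add: f_def moment)
  qed
  have M: "M 0 0 p q = (if p = q then fact p * (2 * of_real (s\<^sup>2)) ^ p else 0)"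
  proof (rule gaussian_moment_algebra[where M = M])
    show "M a b (Suc p) q = M (Suc a) b p q + \<i> * M a (Suc b) p q" for a b p q
      unfolding M_def f_Suc by (simp add: int)
    show "M a b p (Suc q) = M (Suc a) b p q - \<i> * M a (Suc b) p q" for a b p q
      unfolding M_def f_Suc by (simp add: int)
    show "M (Suc a) b 0 0 = of_real (s\<^sup>2) * of_nat a * M (a - 1) b 0 0" for a b
      unfolding M00 normal_moment_Suc[OF s(1)] by simp
    show "M a (Suc b) 0 0 = of_real (s\<^sup>2) * of_nat b * M a (b - 1) 0 0" for a b
      unfolding M00 normal_moment_Suc[OF s(1)] by simp
    show "M 0 0 0 0 = 1"
      using normal_moment_even_value[OF s(1), of 0] by (simp add: M00)
  qed
  have s2: "2 * complex_of_real (s\<^sup>2) = of_real v" using s(2) by (metis of_real_mult of_real_numeral)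
  have cg: "complex_gaussian v = distr (N \<Otimes>\<^sub>M N) borel (\<lambda>(x, y). Complex x y)"
    by (simp add: complex_gaussian_def N_def s_def)
  have meas: "(\<lambda>(x, y). Complex x y) \<in> borel_measurable (N \<Otimes>\<^sub>M N)"
    unfolding Complex_eq case_prod_beta by measurable
  have meas': "(\<lambda>z. z ^ p * cnj z ^ q) \<in> borel_measurable borel"
    by (intro borel_measurable_continuous_onI continuous_intros)
  have fz: "(\<lambda>x. (case x of (x, y) \<Rightarrow> Complex x y) ^ p * cnj (case x of (x, y) \<Rightarrow> Complex x y) ^ q) = f 0 0 p q"
    by (auto simp: f_def)
  show "integrable (complex_gaussian v) (\<lambda>z. z ^ p * cnj z ^ q)"
    unfolding cg integrable_distr_eq[OF meas meas'] fz by (rule int)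
  show "(\<integral>z. z ^ p * cnj z ^ q \<partial>complex_gaussian v) = (if p = q then fact p * of_real v ^ p else 0)"
    unfolding cg integral_distr[OF meas meas'] fz using M by (simp only: M_def s2)
qed

lemma prob_space_complex_gaussian:
  assumes "v > 0" shows "prob_space (complex_gaussian v)"
proof -
  interpret N: prob_space "centred_normal (sqrt (v / 2))"
    by (rule prob_space_normal_density) (use assms in simp)
  interpret P: pair_prob_space "centred_normal (sqrt (v / 2))" "centred_normal (sqrt (v / 2))" ..
  show ?thesis
    unfolding complex_gaussian_def
    by (rule P.prob_space_distr, unfold Complex_eq case_prod_beta) measurable
qed


section \<open>Moments of the random matrix\<close>

definition herm_entry :: "(nat \<times> nat \<Rightarrow> complex) \<Rightarrow> nat \<times> nat \<Rightarrow> complex" where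
  "herm_entry t e = (if fst e < snd e then t e else cnj (t (prod.swap e)))"

definition geval :: "(nat \<times> nat \<Rightarrow> complex) \<Rightarrow> gpoly \<Rightarrow> complex" where
  "geval t = lin_ext (\<lambda>m. \<Prod>e\<in>#m. herm_entry t e)"

lemma geval_simps [simp]:
  "geval t 0 = 0" "geval t 1 = 1" "geval t (P + Q) = geval t P + geval t Q"
  "geval t (P * Q) = geval t P * geval t Q" "geval t (\<Sum>x\<in>A. g x) = (\<Sum>x\<in>A. geval t (g x))"
  "geval t (gvar i j) = herm_entry t (i, j)"
  by (simp_all add: geval_def lin_ext_add lin_ext_mult lin_ext_sum gvar_def flip: single_one)

definition edges_below :: "nat \<Rightarrow> (nat \<times> nat) set" where
  "edges_below d = {(i, j). i < j \<and> j < d}"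

lemma finite_edges_below: "finite (edges_below d)"
  by (rule finite_subset[of _ "{..<d} \<times> {..<d}"]) (auto simp: edges_below_def)

text \<open>Integrals are compared with formal expectations monomial by monomial. For this the variables have
  to be entries of the matrix in question, and the common degree determines the power of the
  variance.\<close>
definition homogeneous :: "(nat \<times> nat) set \<Rightarrow> nat \<Rightarrow> gpoly \<Rightarrow> bool" where
  "homogeneous S n P \<longleftrightarrow> (\<forall>m\<in>Poly_Mapping.keys P. set_mset m \<subseteq> S \<and> size m = n)"

lemma homogeneous_add: "homogeneous S n P \<Longrightarrow> homogeneous S n Q \<Longrightarrow> homogeneous S n (P + Q)"
  using Poly_Mapping.keys_add[of P Q] by (auto simp: homogeneous_def)

lemma homogeneous_0: "homogeneous S n 0"
  by (simp add: homogeneous_def)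

lemma homogeneous_1: "homogeneous S 0 1"
  by (simp add: homogeneous_def)

lemma homogeneous_sum: "(\<And>x. x \<in> A \<Longrightarrow> homogeneous S n (g x)) \<Longrightarrow> homogeneous S n (\<Sum>x\<in>A. g x)"
  by (induction A rule: infinite_finite_induct) (auto simp: homogeneous_0 homogeneous_add)

lemma homogeneous_mult:
  "homogeneous S n P \<Longrightarrow> homogeneous S n' Q \<Longrightarrow> homogeneous S (n + n') (P * Q)"
  using Poly_Mapping.keys_mult[of P Q] unfolding homogeneous_def by fastforce

lemma homogeneous_word_entry:
  assumes "i < d"
  shows "homogeneous (edges_below d \<union> prod.swap ` edges_below d) (length w) (word_entry (<) {..<d} w i j)"
  using assms
proof (induction w arbitrary: i)
  case Nil
  then show ?case by (auto simp: homogeneous_0 homogeneous_1)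
next
  case (Cons c w)
  have "homogeneous (edges_below d \<union> prod.swap ` edges_below d) 1 (step (<) c i k)" if "k < d" for k
    using that Cons.prems
    by (cases c) (auto simp: step_def gvar_def homogeneous_def edges_below_def image_iff)
  then have "homogeneous (edges_below d \<union> prod.swap ` edges_below d) (1 + length w)
     (step (<) c i k * word_entry (<) {..<d} w k j)" if "k < d" for k
    using that Cons.IH by (intro homogeneous_mult) auto
  then show ?case by (auto intro!: homogeneous_sum)
qed

text \<open>Collecting the powers of \<open>t e\<close> and of its conjugate for every edge \<open>e\<close> makes the monomial a product
  of functions of independent entries, so the integral is a product of one-variable moments.\<close>
lemma integral_monomial:
  assumes d: "d > 0" and m: "set_mset m \<subseteq> edges_below d \<union> prod.swap ` edges_below d"
  defines "v \<equiv> 1 / real d"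
  shows "integrable (entries_measure d) (\<lambda>t. \<Prod>e\<in>#m. herm_entry t e)"
    and "(\<integral>t. (\<Prod>e\<in>#m. herm_entry t e) \<partial>entries_measure d) = of_nat (wick m) * of_real (sqrt v) ^ size m"
proof -
  let ?I = "edges_below d" and ?sw = "prod.swap :: nat \<times> nat \<Rightarrow> nat \<times> nat"
  have v: "v > 0" using d by (simp add: v_def)
  interpret G: prob_space "complex_gaussian v" by (rule prob_space_complex_gaussian[OF v])
  interpret product_sigma_finite "\<lambda>_ :: nat \<times> nat. complex_gaussian v" ..
  have disj: "?I \<inter> ?sw ` ?I = {}" by (auto simp: edges_below_def)
  have inj: "inj_on ?sw ?I" by (auto simp: inj_on_def)
  note fin = finite_edges_below[of d]
  have monom: "(\<Prod>e\<in>#m. herm_entry t e) = (\<Prod>e\<in>?I. t e ^ count m e * cnj (t e) ^ count m (?sw e))" for t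
  proof -
    have "(\<Prod>e\<in>#m. herm_entry t e) = (\<Prod>e\<in>set_mset m. herm_entry t e ^ count m e)"
      by (rule image_prod_mset_multiplicity)
    also have "\<dots> = (\<Prod>e\<in>?I \<union> ?sw ` ?I. herm_entry t e ^ count m e)"
      by (rule prod.mono_neutral_left) (use m fin in \<open>auto simp: not_in_iff\<close>)
    also have "\<dots> = (\<Prod>e\<in>?I. herm_entry t e ^ count m e) * (\<Prod>e\<in>?I. herm_entry t (?sw e) ^ count m (?sw e))"
      using fin disj inj by (simp add: prod.union_disjoint prod.reindex)
    also have "\<dots> = (\<Prod>e\<in>?I. t e ^ count m e * cnj (t e) ^ count m (?sw e))"
      unfolding prod.distrib[symmetric]
      by (intro prod.cong refl) (auto simp: herm_entry_def edges_below_def)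
    finally show ?thesis .
  qed
  have E: "entries_measure d = PiM ?I (\<lambda>_. complex_gaussian v)"
    by (simp add: entries_measure_def edges_below_def v_def)
  show "integrable (entries_measure d) (\<lambda>t. \<Prod>e\<in>#m. herm_entry t e)"
    unfolding E monom by (rule product_integrable_prod[OF fin]) (rule complex_gaussian_moment(1)[OF v])
  have "(\<integral>t. (\<Prod>e\<in>#m. herm_entry t e) \<partial>entries_measure d) =
    (\<Prod>e\<in>?I. if count m e = count m (?sw e) then fact (count m e) * of_real v ^ count m e else 0)"
    unfolding E monom
    by (subst product_integral_prod[OF fin]) (simp_all add: complex_gaussian_moment[OF v])
  also have "\<dots> = of_nat (wick m) * of_real (sqrt v) ^ size m"
  proof (cases "\<forall>e\<in>?I. count m e = count m (?sw e)")
    case True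
    have bal: "\<forall>i j. count m (i, j) = count m (j, i)"
    proof (intro allI)
      fix i j
      consider "(i, j) \<in> ?I" | "(j, i) \<in> ?I" | "(i, j) \<notin># m" "(j, i) \<notin># m"
        using m by (force simp: subset_iff)
      then show "count m (i, j) = count m (j, i)"
        using True by cases (force simp: not_in_iff)+
    qed
    have "wick m = (\<Prod>e\<in>(?I \<union> ?sw ` ?I) \<inter> {e. fst e < snd e}. fact (count m e))"
      by (rule wick_superset) (use m bal fin in auto)
    also have "(?I \<union> ?sw ` ?I) \<inter> {e. fst e < snd e} = ?I" by (auto simp: edges_below_def)
    finally have w: "wick m = (\<Prod>e\<in>?I. fact (count m e))" .
    have "size m = (\<Sum>e\<in>set_mset m. count m e)" by (rule size_multiset_overloaded_eq)
    also have "\<dots> = (\<Sum>e\<in>?I \<union> ?sw ` ?I. count m e)"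
      by (rule sum.mono_neutral_left) (use m fin in \<open>auto simp: not_in_iff\<close>)
    also have "\<dots> = (\<Sum>e\<in>?I. 2 * count m e)"
      using fin disj inj True by (simp add: sum.union_disjoint sum.reindex mult_2 sum.distrib)
    finally have "size m = (\<Sum>e\<in>?I. 2 * count m e)" .
    then have "of_real (sqrt v) ^ size m = (\<Prod>e\<in>?I. complex_of_real v ^ count m e)"
      using v by (simp add: power_sum power_mult flip: of_real_power)
    then show ?thesis using True by (simp add: w prod.distrib)
  next
    case False
    then obtain i j where ij: "(i, j) \<in> ?I" "count m (i, j) \<noteq> count m (j, i)" by force
    then have "wick m = 0" by (auto simp: wick_def)
    moreover have "(\<Prod>e\<in>?I. if count m e = count m (?sw e)
        then fact (count m e) * complex_of_real v ^ count m e else 0) = 0"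
      using fin ij by (intro prod_zero bexI[of _ "(i, j)"]) auto
    ultimately show ?thesis by simp
  qed
  finally show "(\<integral>t. (\<Prod>e\<in>#m. herm_entry t e) \<partial>entries_measure d) = of_nat (wick m) * of_real (sqrt v) ^ size m" .
qed

lemma integral_geval:
  assumes d: "d > 0" and P: "homogeneous (edges_below d \<union> prod.swap ` edges_below d) n P"
  shows "(\<integral>t. geval t P \<partial>entries_measure d) = of_nat (gexp P) * of_real (sqrt (1 / real d)) ^ n"
proof -
  have "(\<integral>t. geval t P \<partial>entries_measure d) =
    (\<Sum>m\<in>Poly_Mapping.keys P. of_nat (Poly_Mapping.lookup P m) * (\<integral>t. (\<Prod>e\<in>#m. herm_entry t e) \<partial>entries_measure d))"
    unfolding geval_def lin_ext_def
    using P by (subst Bochner_Integration.integral_sum) (auto simp: homogeneous_def intro!: integrable_mult_right integral_monomial[OF d])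
  also have "\<dots> = (\<Sum>m\<in>Poly_Mapping.keys P. of_nat (Poly_Mapping.lookup P m) * (of_nat (wick m) * of_real (sqrt (1 / real d)) ^ n))"
    using P by (intro sum.cong refl) (auto simp: homogeneous_def integral_monomial[OF d])
  finally show ?thesis
    by (simp add: gexp_def lin_ext_def sum_distrib_right mult.assoc)
qed

lemma mat_word_entry:
  assumes "i < d" "j < d"
  shows "mat_word d (upper_mat d t) w $$ (i, j) = geval t (word_entry (<) {..<d} w i j)"
proof -
  have dim: "mat_word d (upper_mat d t) w \<in> carrier_mat d d" for w
    by (induction w) (auto simp: mat_word_def upper_mat_def mat_adjoint_def split: letter.splits)
  show ?thesis using assms
  proof (induction w arbitrary: i)
    case Nil
    then show ?case by (simp add: mat_word_def)
  next
    case (Cons c w)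
    define X where "X = (case c of Star \<Rightarrow> mat_adjoint (upper_mat d t) | Plain \<Rightarrow> upper_mat d t)"
    have X: "X \<in> carrier_mat d d" "X $$ (i, k) = geval t (step (<) c i k)" if "k < d" for k
      using that Cons.prems
      by (cases c; auto simp: X_def upper_mat_def mat_adjoint_def mat_of_rows_def step_def herm_entry_def)+
    have "mat_word d (upper_mat d t) (c # w) = X * mat_word d (upper_mat d t) w"
      by (simp add: mat_word_def X_def)
    then have "mat_word d (upper_mat d t) (c # w) $$ (i, j) =
      (\<Sum>k\<in>{0..<d}. X $$ (i, k) * mat_word d (upper_mat d t) w $$ (k, j))"
      using X(1)[of 0] dim[of w] Cons.prems by (auto simp: scalar_prod_def)
    then show ?case using X(2) Cons by (simp add: atLeast0LessThan)
  qed
qed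

text \<open>The entries have variance \<open>1/d\<close>, so each letter contributes a factor \<open>1/\<surd>d\<close>; the remaining \<open>1/d\<close>
  normalises the trace.\<close>
theorem mat_moment_trace_moment:
  assumes "d > 0"
  shows "mat_moment d w = of_nat (trace_moment d [w]) / (of_nat d * of_real (sqrt (real d)) ^ length w)"
proof -
  have "mat_moment d w = (1 / of_nat d) * (\<integral>t. geval t (word_trace (<) {..<d} w) \<partial>entries_measure d)"
    by (simp add: mat_moment_def mat_word_entry word_trace_def)
  also have "(\<integral>t. geval t (word_trace (<) {..<d} w) \<partial>entries_measure d) =
     of_nat (gexp (word_trace (<) {..<d} w)) * of_real (sqrt (1 / real d)) ^ length w"
    unfolding word_trace_def
    by (rule integral_geval[OF assms]) (auto intro!: homogeneous_sum homogeneous_word_entry)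
  also have "gexp (word_trace (<) {..<d} w) = trace_moment d [w]"
    using trace_moment_less[of d "[w]"] by simp
  finally show ?thesis by (simp add: real_sqrt_divide power_divide)
qed


section \<open>Growth of the trace moments\<close>

text \<open>The increments of \<open>a - L b\<close> are eventually small against those of \<open>b\<close>, hence so are their sums.\<close>
lemma stolz_cesaro:
  fixes a :: "nat \<Rightarrow> 'a::real_normed_vector" and b :: "nat \<Rightarrow> real"
  assumes b_less: "\<And>n. b n < b (Suc n)" and b_top: "filterlim b at_top sequentially"
    and lim: "(\<lambda>n. (a (Suc n) - a n) /\<^sub>R (b (Suc n) - b n)) \<longlonglongrightarrow> L"
  shows "(\<lambda>n. a n /\<^sub>R b n) \<longlonglongrightarrow> L"
proof (rule tendstoI)
  fix e :: real assume e: "e > 0"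
  have "\<forall>\<^sub>F n in sequentially. dist ((a (Suc n) - a n) /\<^sub>R (b (Suc n) - b n)) L < e / 3"
    using lim e by (intro tendstoD) auto
  then obtain N where N: "\<And>n. n \<ge> N \<Longrightarrow> dist ((a (Suc n) - a n) /\<^sub>R (b (Suc n) - b n)) L < e / 3"
    by (auto simp: eventually_sequentially)
  have diff: "norm ((a (Suc n) - a n) - (b (Suc n) - b n) *\<^sub>R L) \<le> e / 3 * (b (Suc n) - b n)" if "n \<ge> N" for n
  proof -
    define D where "D = b (Suc n) - b n"
    have D: "D > 0" using b_less by (simp add: D_def)
    have "(a (Suc n) - a n) - D *\<^sub>R L = D *\<^sub>R ((a (Suc n) - a n) /\<^sub>R D - L)"
      using D by (simp add: scaleR_diff_right)
    then have "norm ((a (Suc n) - a n) - D *\<^sub>R L) = D * dist ((a (Suc n) - a n) /\<^sub>R D) L"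
      using D by (simp add: dist_norm)
    then show ?thesis using N[OF that] D by (simp add: D_def)
  qed
  have sum: "norm ((a n - a N) - (b n - b N) *\<^sub>R L) \<le> e / 3 * (b n - b N)" if "n \<ge> N" for n
    using that
  proof (induction n rule: dec_induct)
    case (step n)
    have eq: "(a (Suc n) - a N) - (b (Suc n) - b N) *\<^sub>R L =
      ((a (Suc n) - a n) - (b (Suc n) - b n) *\<^sub>R L) + ((a n - a N) - (b n - b N) *\<^sub>R L)"
      by (simp add: scaleR_diff_left)
    have "norm ((a (Suc n) - a N) - (b (Suc n) - b N) *\<^sub>R L) \<le>
      e / 3 * (b (Suc n) - b n) + e / 3 * (b n - b N)"
      unfolding eq by (rule norm_triangle_mono[OF diff[OF step.hyps(1)] step.IH])
    also have "\<dots> = e / 3 * (b (Suc n) - b N)" by (simp add: field_simps)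
    finally show ?case .
  qed simp
  \<comment> \<open>\<open>C\<close> bounds the contribution of the terms before \<open>N\<close>, which \<open>b n\<close> eventually dominates\<close>
  define C where "C = norm (a N - b N *\<^sub>R L) + e / 3 * \<bar>b N\<bar>"
  have "\<forall>\<^sub>F n in sequentially. b n > 3 * C / e + 1"
    using b_top by (simp add: filterlim_at_top_dense)
  moreover have "\<forall>\<^sub>F n in sequentially. n \<ge> N" by (rule eventually_ge_at_top)
  ultimately show "\<forall>\<^sub>F n in sequentially. dist (a n /\<^sub>R b n) L < e"
  proof eventually_elim
    case (elim n)
    have "C \<ge> 0" using e by (simp add: C_def)
    then have "3 * C / e \<ge> 0" using e by simp
    then have bn: "b n > 0" using elim(1) by linarith
    have "3 * C / e < b n" using elim(1) by linarith
    then have C: "C < e / 3 * b n" using e by (simp add: field_simps)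
    have "a n - b n *\<^sub>R L = ((a n - a N) - (b n - b N) *\<^sub>R L) + (a N - b N *\<^sub>R L)"
      by (simp add: scaleR_diff_left)
    then have "norm (a n - b n *\<^sub>R L) \<le> e / 3 * (b n - b N) + norm (a N - b N *\<^sub>R L)"
      using norm_triangle_mono[OF sum[OF elim(2)] order_refl] by (simp only:)
    also have "\<dots> \<le> e / 3 * b n + C"
    proof -
      have "e * (b N + \<bar>b N\<bar>) \<ge> 0" using e by (intro mult_nonneg_nonneg) auto
      then show ?thesis by (simp add: C_def algebra_simps)
    qed
    also have "\<dots> < e * b n" using C mult_pos_pos[OF e bn] by (simp add: field_simps)
    finally have *: "norm (a n - b n *\<^sub>R L) < e * b n" .
    have "a n - b n *\<^sub>R L = b n *\<^sub>R (a n /\<^sub>R b n - L)"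
      using bn by (simp add: scaleR_diff_right)
    then have "norm (a n - b n *\<^sub>R L) = b n * dist (a n /\<^sub>R b n) L"
      using bn by (simp add: dist_norm)
    then show ?case using * bn by (simp add: mult.commute)
  qed
qed

lemma power_difference_asymptotics:
  "(\<lambda>d. (sqrt (real (Suc d)) ^ (n + 2) - sqrt (real d) ^ (n + 2)) / sqrt (real d) ^ n) \<longlonglongrightarrow> real (n + 2) / 2"
proof -
  define c where "c = real (n + 2) / 2"
  have c: "c > 0" by (simp add: c_def)
  have *: "sqrt (real d) ^ k = real d powr (real k / 2)" if "d > 0" for d k
  proof -
    have "sqrt (real d) ^ k = sqrt (real d) powr real k"
      using that by (intro powr_realpow[symmetric]) simp
    also have "\<dots> = (real d powr (1 / 2)) powr real k" by (simp add: powr_half_sqrt)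
    also have "\<dots> = real d powr (real k / 2)" by (subst powr_powr) simp
    finally show ?thesis .
  qed
  have "(\<lambda>d. (real (Suc d) powr c - real d powr c) / real d powr (c - 1)) \<longlonglongrightarrow> c"
    using c by real_asymp
  moreover have "\<forall>\<^sub>F d in sequentially. (real (Suc d) powr c - real d powr c) / real d powr (c - 1) =
     (sqrt (real (Suc d)) ^ (n + 2) - sqrt (real d) ^ (n + 2)) / sqrt (real d) ^ n"
    using eventually_gt_at_top[of 0]
  proof eventually_elim
    case (elim d)
    have c': "c - 1 = real n / 2" by (simp add: c_def field_simps)
    have "sqrt (real (Suc d)) ^ (n + 2) = real (Suc d) powr c" "sqrt (real d) ^ (n + 2) = real d powr c"
      "sqrt (real d) ^ n = real d powr (c - 1)"
      unfolding c' unfolding c_def by (rule *; use elim in simp)+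
    then show ?case by (simp only:)
  qed
  ultimately show ?thesis unfolding c_def by (rule Lim_transform_eventually)
qed

lemma stolz_cesaro_power:
  fixes a :: "nat \<Rightarrow> complex"
  assumes "(\<lambda>d. (a (Suc d) - a d) / of_real (sqrt (real d) ^ n)) \<longlonglongrightarrow> L"
  shows "(\<lambda>d. a d / of_real (sqrt (real d) ^ (n + 2))) \<longlonglongrightarrow> 2 * L / of_nat (n + 2)"
proof -
  define b where "b d = sqrt (real d) ^ (n + 2)" for d
  have less: "b d < b (Suc d)" for d
    unfolding b_def by (intro power_strict_mono) auto
  have top: "filterlim b at_top sequentially"
    unfolding b_def by (intro filterlim_pow_at_top filterlim_compose[OF sqrt_at_top] filterlim_real_sequentially) simp
  have "(\<lambda>d. ((a (Suc d) - a d) / of_real (sqrt (real d) ^ n)) / of_real ((b (Suc d) - b d) / sqrt (real d) ^ n))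
     \<longlonglongrightarrow> L / of_real (real (n + 2) / 2)"
    unfolding b_def by (rule tendsto_divide[OF assms tendsto_of_real[OF power_difference_asymptotics]], subst of_real_eq_0_iff) simp
  moreover have "\<forall>\<^sub>F d in sequentially.
      ((a (Suc d) - a d) / of_real (sqrt (real d) ^ n)) / of_real ((b (Suc d) - b d) / sqrt (real d) ^ n) =
      (a (Suc d) - a d) /\<^sub>R (b (Suc d) - b d)"
    using eventually_gt_at_top[of 0]
  proof eventually_elim
    case (elim d)
    define P D where "P = sqrt (real d) ^ n" and "D = b (Suc d) - b d"
    have "P \<noteq> 0" "D \<noteq> 0" using elim less[of d] by (simp_all add: P_def D_def)
    then show ?case unfolding P_def[symmetric] D_def[symmetric]
      by (simp add: scaleR_conv_of_real divide_inverse)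
  qed
  ultimately have "(\<lambda>d. (a (Suc d) - a d) /\<^sub>R (b (Suc d) - b d)) \<longlonglongrightarrow> L / of_real (real (n + 2) / 2)"
    by (rule Lim_transform_eventually)
  from stolz_cesaro[OF less top this]
  have "(\<lambda>d. a d / of_real (b d)) \<longlonglongrightarrow> L / of_real (real (n + 2) / 2)"
    by (simp only: scaleR_conv_of_real of_real_inverse divide_inverse mult.commute)
  also have "L / of_real (real (n + 2) / 2) = 2 * L / of_nat (n + 2)"
    by simp
  finally show ?thesis unfolding b_def .
qed

text \<open>Twice the exponent with which the expectation of a product of traces grows: a word with \<open>m\<close> pairs
  of letters has a tree with \<open>m + 1\<close> vertices, each of which is a free index. The factor 2 keeps the
  exponent integral for words of odd length.\<close>
definition weight :: "word list \<Rightarrow> nat" where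
  "weight ws = (\<Sum>w\<leftarrow>ws. length w + 2)"

lemma weight_simps [simp]:
  "weight [] = 0" "weight (w # ws) = length w + 2 + weight ws" "weight (ws @ vs) = weight ws + weight vs"
  by (simp_all add: weight_def)

text \<open>A merge saves one trace and therefore costs one power of the size.\<close>
lemma weight_merges: "us' \<in> set (merges u us) \<Longrightarrow> weight us' + 2 = weight (u # us)"
  by (induction us arbitrary: us') auto

lemma weight_returns: "us \<in> set (returns w) \<Longrightarrow> weight us = length w"
proof (induction w arbitrary: us rule: returns.induct)
  case (3 w)
  from "3.prems" obtain p vs where p: "p \<in> set (splits_at Star w)" and vs: "vs \<in> set (returns (snd p))"
    and us: "us = fst p # vs" by auto
  show ?case using "3.IH"[OF p vs] splits_at_length[OF p] by (simp add: us)
qed auto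

text \<open>Visiting the new vertex costs one power of the size, which is the vertex itself: in a nonempty
  word \<open>r\<close> visits drop \<open>2r\<close> letters and create \<open>r - 1\<close> additional words.\<close>
lemma weight_visits:
  assumes "us \<in> set (visits w)"
  shows "weight us = length w"
proof -
  from assms consider "us \<in> set (returns w)" | p q vs where "p \<in> set (splits_at Plain w)"
    "q \<in> set (splits_at Star (fst p))" "vs \<in> set (returns (snd q))" "us = (snd p @ fst q) # vs"
    by (auto simp: visits_def)
  then show ?thesis
  proof cases
    case (2 p q vs)
    then show ?thesis using splits_at_length[OF 2(1)] splits_at_length[OF 2(2)] weight_returns[OF 2(3)] by simp
  qed (rule weight_returns)
qed

lemma expand_head: "expand ws = (ws, []) # tl (expand ws)"
proof -
  have "\<exists>r. expand ws = (ws, []) # r" by (induction ws) auto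
  then show ?thesis by auto
qed

lemma tl_expand_Cons:
  "tl (expand (w # ws)) = map (\<lambda>p. (w # fst p, snd p)) (tl (expand ws)) @
     concat (map (\<lambda>us. map (\<lambda>p. (fst p, us @ snd p)) (expand ws)) (visits w))"
  using expand_head[of ws] by (cases "expand ws") auto

lemma weight_expand_le: "p \<in> set (expand ws) \<Longrightarrow> weight (fst p) + weight (snd p) \<le> weight ws"
proof (induction ws arbitrary: p)
  case (Cons w ws)
  from Cons.prems consider q where "q \<in> set (expand ws)" "p = (w # fst q, snd q)"
    | q us where "q \<in> set (expand ws)" "us \<in> set (visits w)" "p = (fst q, us @ snd q)"
    by auto
  then show ?case
  proof cases
    case 1
    then show ?thesis using Cons.IH[OF 1(1)] by simp
  next
    case 2
    then show ?thesis using Cons.IH[OF 2(1)] weight_visits[OF 2(2)] by simp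
  qed
qed simp

lemma weight_tl_expand: "p \<in> set (tl (expand ws)) \<Longrightarrow> weight (fst p) + weight (snd p) + 2 \<le> weight ws"
proof (induction ws arbitrary: p)
  case (Cons w ws)
  from Cons.prems consider q where "q \<in> set (tl (expand ws))" "p = (w # fst q, snd q)"
    | q us where "q \<in> set (expand ws)" "us \<in> set (visits w)" "p = (fst q, us @ snd q)"
    unfolding tl_expand_Cons by auto
  then show ?case
  proof cases
    case 1
    then show ?thesis using Cons.IH[OF 1(1)] by simp
  next
    case 2
    then show ?thesis using weight_expand_le[OF 2(1)] weight_visits[OF 2(2)] by simp
  qed
qed simp

lemma tendsto_sum_list:
  fixes f :: "'b \<Rightarrow> 'c \<Rightarrow> 'a::topological_comm_monoid_add"
  assumes "\<And>x. x \<in> set xs \<Longrightarrow> ((\<lambda>d. f d x) \<longlongrightarrow> g x) F"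
  shows "((\<lambda>d. \<Sum>x\<leftarrow>xs. f d x) \<longlongrightarrow> (\<Sum>x\<leftarrow>xs. g x)) F"
  using assms by (induction xs) (auto intro!: tendsto_add)

definition normalised :: "(nat \<Rightarrow> nat) \<Rightarrow> nat \<Rightarrow> nat \<Rightarrow> complex" where
  "normalised f n d = of_nat (f d) / of_real (sqrt (real d) ^ n)"

lemma normalised_higher:
  assumes "normalised f n \<longlonglongrightarrow> L" "n < n'"
  shows "normalised f n' \<longlonglongrightarrow> 0"
proof -
  obtain k where n': "n' = n + Suc k" using assms(2) less_imp_Suc_add by fastforce
  have "(\<lambda>d. inverse (sqrt (real d) ^ Suc k)) \<longlonglongrightarrow> 0"
    by (intro tendsto_inverse_0_at_top filterlim_pow_at_top filterlim_compose[OF sqrt_at_top] filterlim_real_sequentially) simp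
  then have "(\<lambda>d. normalised f n d * of_real (inverse (sqrt (real d) ^ Suc k))) \<longlonglongrightarrow> L * of_real 0"
    by (intro tendsto_mult assms tendsto_of_real)
  then show ?thesis
    by (simp add: normalised_def[abs_def] n' power_add divide_inverse mult_ac)
qed

context
  fixes t :: "word \<Rightarrow> complex"
begin

abbreviation prod_limit :: "word list \<Rightarrow> complex" where
  "prod_limit ws \<equiv> (\<Prod>w\<leftarrow>ws. t w)"

text \<open>Asymptotic factorisation: the joint moment of traces behaves like the product of the limits \<open>t w\<close>
  of the single ones.\<close>
definition factorises :: "word list \<Rightarrow> bool" where
  "factorises ws \<longleftrightarrow> normalised (\<lambda>d. trace_moment d ws) (weight ws) \<longlonglongrightarrow> prod_limit ws"

text \<open>Closing every form to a trace preserves the weight and every merge lowers it, so only the former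
  survives.\<close>
lemma contract_limit:
  assumes "\<And>vs. weight vs \<le> n \<Longrightarrow> factorises vs" "weight ws + weight us \<le> n"
  shows "normalised (\<lambda>d. contract (trace_moment d) ws us) (weight ws + weight us)
    \<longlonglongrightarrow> prod_limit ws * prod_limit us"
  using assms(2)
proof (induction "length us" arbitrary: ws us)
  case 0
  then show ?case using assms(1)[of ws] by (simp add: factorises_def)
next
  case (Suc k)
  then obtain u vs where us: "us = u # vs" "length vs = k" by (cases us) auto
  let ?m = "weight ws + weight us"
  have "normalised (\<lambda>d. contract (trace_moment d) (u # ws) vs) ?m \<longlonglongrightarrow> prod_limit (u # ws) * prod_limit vs"
    using Suc.hyps(1)[of vs "u # ws"] Suc.prems us by (simp add: add_ac)
  moreover have "(\<lambda>d. \<Sum>us'\<leftarrow>merges u vs. normalised (\<lambda>d. contract (trace_moment d) ws us') ?m d) \<longlonglongrightarrow>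
      (\<Sum>us'\<leftarrow>merges u vs. 0)"
  proof (rule tendsto_sum_list)
    fix us' assume us': "us' \<in> set (merges u vs)"
    have "normalised (\<lambda>d. contract (trace_moment d) ws us') (weight ws + weight us') \<longlonglongrightarrow> prod_limit ws * prod_limit us'"
      using Suc.hyps(1)[of us' ws] us length_merges[OF us'] weight_merges[OF us'] Suc.prems by simp
    then show "normalised (\<lambda>d. contract (trace_moment d) ws us') ?m \<longlonglongrightarrow> 0"
      by (rule normalised_higher) (use weight_merges[OF us'] us in simp)
  qed
  ultimately have "(\<lambda>d. normalised (\<lambda>d. contract (trace_moment d) (u # ws) vs) ?m d +
      (\<Sum>us'\<leftarrow>merges u vs. normalised (\<lambda>d. contract (trace_moment d) ws us') ?m d))
      \<longlonglongrightarrow> prod_limit (u # ws) * prod_limit vs + (\<Sum>us'\<leftarrow>merges u vs. 0)"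
    by (rule tendsto_add)
  moreover have "of_nat (\<Sum>x\<leftarrow>xs. f x) / c = (\<Sum>x\<leftarrow>xs. of_nat (f x) / c)" for f :: "word list \<Rightarrow> nat" and xs and c :: complex
    by (induction xs) (auto simp: add_divide_distrib)
  ultimately show ?case
    by (simp add: us normalised_def[abs_def] add_divide_distrib mult_ac)
qed

definition visit_sum :: "word \<Rightarrow> complex" where
  "visit_sum w = (\<Sum>us\<leftarrow>visits w. prod_limit us)"

text \<open>The terms in which exactly one of the words visits the new vertex.\<close>
fun derivation_sum :: "word list \<Rightarrow> complex" where
  "derivation_sum [] = 0"
| "derivation_sum (w # ws) = t w * derivation_sum ws + visit_sum w * prod_limit ws"

text \<open>Each word that visits the new vertex lowers the weight by 2, so the leading terms are those with a
  single such word.\<close>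
lemma derivation_sum_expand:
  "(\<Sum>p\<leftarrow>tl (expand ws). if weight (fst p) + weight (snd p) + 2 = weight ws
      then prod_limit (fst p) * prod_limit (snd p) else 0) = derivation_sum ws"
proof (induction ws)
  case (Cons w ws)
  let ?f = "\<lambda>ws p. if weight (fst p) + weight (snd p) + 2 = weight ws then prod_limit (fst p) * prod_limit (snd p) else 0"
  have A: "(\<Sum>p\<leftarrow>tl (expand ws). ?f (w # ws) (w # fst p, snd p)) = t w * (\<Sum>p\<leftarrow>tl (expand ws). ?f ws p)"
    unfolding sum_list_const_mult[symmetric]
    by (intro arg_cong[where f = sum_list] map_cong) auto
  have B: "(\<Sum>p\<leftarrow>expand ws. ?f (w # ws) (fst p, us @ snd p)) = prod_limit us * prod_limit ws"
    if us: "us \<in> set (visits w)" for us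
  proof -
    have "(\<Sum>p\<leftarrow>tl (expand ws). ?f (w # ws) (fst p, us @ snd p)) = (\<Sum>p\<leftarrow>tl (expand ws). 0)"
      using weight_visits[OF us] weight_tl_expand[of _ ws]
      by (intro arg_cong[where f = sum_list] map_cong) fastforce+
    then show ?thesis
      using weight_visits[OF us] by (subst expand_head) simp
  qed
  have "(\<Sum>p\<leftarrow>tl (expand (w # ws)). ?f (w # ws) p) = t w * (\<Sum>p\<leftarrow>tl (expand ws). ?f ws p) +
     (\<Sum>us\<leftarrow>visits w. \<Sum>p\<leftarrow>expand ws. ?f (w # ws) (fst p, us @ snd p))"
    unfolding tl_expand_Cons map_append sum_list_append A[symmetric] sum_list_concat_map
    by (simp add: o_def)
  also have "(\<Sum>us\<leftarrow>visits w. \<Sum>p\<leftarrow>expand ws. ?f (w # ws) (fst p, us @ snd p)) =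
     (\<Sum>us\<leftarrow>visits w. prod_limit us * prod_limit ws)"
    by (intro arg_cong[where f = sum_list] map_cong refl B)
  finally show ?case
    using Cons by (simp add: visit_sum_def sum_list_mult_const)
qed simp

text \<open>The head of the expansion, where nothing visits the new vertex, is the moment of size \<open>d\<close> itself;
  the difference consists of the other terms.\<close>
lemma trace_moment_difference:
  assumes good: "\<And>vs. weight vs \<le> n \<Longrightarrow> factorises vs" and ws: "weight ws = n + 2"
  shows "(\<lambda>d. (of_nat (trace_moment (Suc d) ws) - of_nat (trace_moment d ws)) / of_real (sqrt (real d) ^ n))
     \<longlonglongrightarrow> derivation_sum ws"
proof -
  have "(\<lambda>d. \<Sum>p\<leftarrow>tl (expand ws). normalised (\<lambda>d. contract (trace_moment d) (fst p) (snd p)) n d) \<longlonglongrightarrow>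
    (\<Sum>p\<leftarrow>tl (expand ws). if weight (fst p) + weight (snd p) + 2 = weight ws
      then prod_limit (fst p) * prod_limit (snd p) else 0)"
  proof (rule tendsto_sum_list)
    fix p assume p: "p \<in> set (tl (expand ws))"
    have le: "weight (fst p) + weight (snd p) \<le> n"
      using weight_tl_expand[OF p] ws by simp
    note lim = contract_limit[OF good le]
    show "normalised (\<lambda>d. contract (trace_moment d) (fst p) (snd p)) n \<longlonglongrightarrow>
      (if weight (fst p) + weight (snd p) + 2 = weight ws then prod_limit (fst p) * prod_limit (snd p) else 0)"
    proof (cases "weight (fst p) + weight (snd p) = n")
      case True
      then show ?thesis using lim ws by simp
    next
      case False
      then show ?thesis using normalised_higher[OF lim] le ws by simp
    qed
  qed
  moreover have "(of_nat (trace_moment (Suc d) ws) - of_nat (trace_moment d ws)) / of_real (sqrt (real d) ^ n) =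
    (\<Sum>p\<leftarrow>tl (expand ws). normalised (\<lambda>d. contract (trace_moment d) (fst p) (snd p)) n d)" for d
  proof -
    have "of_nat (\<Sum>x\<leftarrow>xs. f x) / c = (\<Sum>x\<leftarrow>xs. of_nat (f x) / c)" for f :: "word list \<times> word list \<Rightarrow> nat" and xs and c :: complex
      by (induction xs) (auto simp: add_divide_distrib)
    moreover have "trace_moment (Suc d) ws = trace_moment d ws +
        (\<Sum>p\<leftarrow>tl (expand ws). contract (trace_moment d) (fst p) (snd p))"
      unfolding trace_moment.simps by (subst expand_head) simp
    ultimately show ?thesis by (simp add: normalised_def)
  qed
  ultimately show ?thesis by (simp only: derivation_sum_expand)
qed

lemma trace_moment_Nil: "trace_moment d [] = 1"
  by (induction d) auto

context
  assumes limits: "\<And>w. factorises [w]"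
begin

text \<open>For a single word the Stolz-Cesaro theorem expresses the limit by the sum over the sets of visits.
  The limit being \<open>t w\<close> by assumption, this determines that sum.\<close>
lemma visit_sum_value_aux:
  assumes "\<And>vs. weight vs \<le> length w \<Longrightarrow> factorises vs"
  shows "visit_sum w = of_nat (length w + 2) / 2 * t w"
proof -
  have "(\<lambda>d. of_nat (trace_moment d [w]) / of_real (sqrt (real d) ^ (length w + 2))) \<longlonglongrightarrow>
     2 * derivation_sum [w] / of_nat (length w + 2)"
    by (rule stolz_cesaro_power, rule trace_moment_difference) (use assms in auto)
  moreover have "(\<lambda>d. of_nat (trace_moment d [w]) / of_real (sqrt (real d) ^ (length w + 2))) \<longlonglongrightarrow> t w"
    using limits[of w] by (simp add: factorises_def normalised_def[abs_def])
  ultimately have "2 * derivation_sum [w] / of_nat (length w + 2) = t w"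
    by (rule LIMSEQ_unique)
  then have "2 * visit_sum w = of_nat (length w + 2) * t w"
    by (simp add: field_simps del: of_nat_add of_nat_Suc)
  then show ?thesis by (simp add: field_simps del: of_nat_add of_nat_Suc)
qed

text \<open>Induction on the weight. By \<open>visit_sum_value_aux\<close> the Leibniz sum \<open>derivation_sum\<close> multiplies the
  product of the limits by half the weight, and this factor is cancelled by the exponent in the
  Stolz-Cesaro theorem.\<close>
lemma factorises_all: "factorises ws"
proof (induction "weight ws" arbitrary: ws rule: less_induct)
  case less
  show ?case
  proof (cases ws)
    case Nil
    then show ?thesis by (simp add: factorises_def normalised_def[abs_def] trace_moment_Nil)
  next
    case (Cons w0 ws0)
    define n where "n = weight ws - 2"
    have n: "weight ws = n + 2" by (simp add: n_def Cons)
    have good: "factorises vs" if "weight vs \<le> n" for vs using less[of vs] that n by simp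
    have "derivation_sum vs = of_nat (weight vs) / 2 * prod_limit vs" if "set vs \<subseteq> set ws" for vs
      using that
    proof (induction vs)
      case (Cons v vs)
      have "length v + 2 \<le> weight ws"
        unfolding weight_def by (rule member_le_sum_list) (use Cons in auto)
      then have "visit_sum v = of_nat (length v + 2) / 2 * t v"
        using n by (intro visit_sum_value_aux good) simp
      then show ?case using Cons by (simp add: algebra_simps add_divide_distrib)
    qed simp
    then have ds: "derivation_sum ws = of_nat (n + 2) / 2 * prod_limit ws" using n by simp
    have "(\<lambda>d. of_nat (trace_moment d ws) / of_real (sqrt (real d) ^ (n + 2))) \<longlonglongrightarrow>
       2 * derivation_sum ws / of_nat (n + 2)"
      by (rule stolz_cesaro_power, rule trace_moment_difference) (use good n in auto)
    also have "2 * derivation_sum ws / of_nat (n + 2) = prod_limit ws"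
      unfolding ds by (simp del: of_nat_add of_nat_Suc)
    finally show ?thesis by (simp add: factorises_def normalised_def[abs_def] n)
  qed
qed

theorem visit_sum_value: "visit_sum w = of_nat (length w + 2) / 2 * t w"
  by (rule visit_sum_value_aux) (rule factorises_all)

end
end

lemma factorises_single_iff:
  "factorises t [w] \<longleftrightarrow> (\<lambda>d. mat_moment d w) \<longlonglongrightarrow> t w"
proof -
  have "\<forall>\<^sub>F d in sequentially. mat_moment d w = normalised (\<lambda>d. trace_moment d [w]) (weight [w]) d"
    using eventually_gt_at_top[of 0]
  proof eventually_elim
    case (elim d)
    have "complex_of_real (sqrt (real d)) * complex_of_real (sqrt (real d)) = of_nat d"
      by (simp flip: of_real_mult)
    then have "complex_of_real (sqrt (real d)) ^ (length w + 2) = of_nat d * of_real (sqrt (real d)) ^ length w"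
      by (simp add: mult_ac)
    then show ?case
      by (simp only: mat_moment_trace_moment[OF elim] normalised_def weight_simps add_0_right of_real_power)
  qed
  then show ?thesis unfolding factorises_def by (auto dest: tendsto_cong)
qed


section \<open>Properties of the limit\<close>

text \<open>Excursions lose one letter of each kind, so the excess is distributed over the excursions of any
  set of visits. Induction on the length then shows that unbalanced words have limit zero.\<close>
definition excess :: "word \<Rightarrow> int" where
  "excess w = (\<Sum>c\<leftarrow>w. case c of Plain \<Rightarrow> 1 | Star \<Rightarrow> -1)"

lemma excess_simps [simp]:
  "excess [] = 0" "excess (Plain # w) = 1 + excess w" "excess (Star # w) = excess w - 1"
  "excess (u @ w) = excess u + excess w"
  by (simp_all add: excess_def)

lemma excess_replicate: "excess (replicate n Plain) = int n" "excess (replicate n Star) = - int n"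
  by (induction n) auto

lemma excess_returns: "us \<in> set (returns w) \<Longrightarrow> (\<Sum>u\<leftarrow>us. excess u) = excess w"
proof (induction w arbitrary: us rule: returns.induct)
  case (3 w)
  from "3.prems" obtain p vs where p: "p \<in> set (splits_at Star w)" and vs: "vs \<in> set (returns (snd p))"
    and us: "us = fst p # vs" by auto
  have "w = fst p @ Star # snd p" using p splits_at_append_eq[of "fst p" "snd p"] by simp
  then show ?case using "3.IH"[OF p vs] us by simp
qed auto

lemma excess_visits:
  assumes "us \<in> set (visits w)"
  shows "(\<Sum>u\<leftarrow>us. excess u) = excess w"
proof -
  from assms consider "us \<in> set (returns w)" | p q vs where "p \<in> set (splits_at Plain w)"
    "q \<in> set (splits_at Star (fst p))" "vs \<in> set (returns (snd q))" "us = (snd p @ fst q) # vs"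
    by (auto simp: visits_def)
  then show ?thesis
  proof cases
    case (2 p q vs)
    have "w = fst p @ Plain # snd p" "fst p = fst q @ Star # snd q"
      using 2 splits_at_append_eq[of "fst p" "snd p"] splits_at_append_eq[of "fst q" "snd q"] by simp_all
    then have "excess w = excess (fst q @ Star # snd q @ Plain # snd p)" by simp
    then show ?thesis using 2(4) excess_returns[OF 2(3)] by simp
  qed (rule excess_returns)
qed

lemma visit_sum_unbalanced:
  assumes visit_sum: "\<And>w. visit_sum t w = of_nat (length w + 2) / 2 * t w" and "excess w \<noteq> 0"
  shows "t w = 0"
  using assms(2)
proof (induction w rule: length_induct)
  case (1 w)
  have "(\<Prod>u\<leftarrow>us. t u) = 0" if us: "us \<in> set (visits w)" for us
  proof -
    have "\<exists>u\<in>set us. excess u \<noteq> 0"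
    proof (rule ccontr)
      assume "\<not> ?thesis"
      then have "(\<Sum>u\<leftarrow>us. excess u) = (\<Sum>u\<leftarrow>us. 0)" by (intro arg_cong[where f = sum_list] map_cong) auto
      then show False using excess_visits[OF us] 1 by simp
    qed
    then obtain u where u: "u \<in> set us" "excess u \<noteq> 0" by blast
    have "length u + 2 \<le> length w"
      unfolding weight_visits[OF us, symmetric] weight_def by (rule member_le_sum_list) (use u in auto)
    then have "t u = 0" using 1 u by simp
    then show ?thesis using u by (auto simp: prod_list_zero_iff)
  qed
  then have "visit_sum t w = (\<Sum>us\<leftarrow>visits w. 0)"
    unfolding visit_sum_def by (intro arg_cong[where f = sum_list] map_cong) auto
  then have "of_nat (length w + 2) * t w = 0" using visit_sum[of w] by simp
  moreover have "complex_of_nat (length w + 2) \<noteq> 0" by (subst of_nat_eq_0_iff) simp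
  ultimately show ?case by simp
qed

definition limit_moments :: "(word \<Rightarrow> complex) \<Rightarrow> bool" where
  "limit_moments t \<longleftrightarrow> (\<forall>w. (\<lambda>d. mat_moment d w) \<longlonglongrightarrow> t w)"

text \<open>Symmetries of the moments at every size carry over to the limit.\<close>
lemma limit_moments_eq:
  assumes "limit_moments t" "length v = length w" "\<And>d. trace_moment d [v] = trace_moment d [w]"
  shows "t v = t w"
proof -
  have "\<forall>\<^sub>F d in sequentially. mat_moment d v = mat_moment d w"
    using eventually_gt_at_top[of 0]
    by eventually_elim (simp add: mat_moment_trace_moment assms)
  then have "(\<lambda>d. mat_moment d w) \<longlonglongrightarrow> t v"
    using assms(1) unfolding limit_moments_def by (blast intro: Lim_transform_eventually)
  then show ?thesis using assms(1) LIMSEQ_unique unfolding limit_moments_def by blast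
qed

lemma limit_moments_visit_sum:
  assumes "limit_moments t"
  shows "visit_sum t w = of_nat (length w + 2) / 2 * t w"
  by (rule visit_sum_value) (use assms in \<open>simp add: factorises_single_iff limit_moments_def\<close>)


section \<open>Visits in alternating words\<close>

lemma splits_at_append:
  "splits_at c (u @ w) = map (\<lambda>p. (fst p, snd p @ w)) (splits_at c u) @ map (\<lambda>p. (u @ fst p, snd p)) (splits_at c w)"
  by (induction u) (auto simp: case_prod_beta)

lemma splits_at_replicate_other: "c \<noteq> c' \<Longrightarrow> splits_at c (replicate n c') = []"
  by (induction n) auto

definition split_sum :: "letter \<Rightarrow> (word \<Rightarrow> word \<Rightarrow> complex) \<Rightarrow> word \<Rightarrow> complex" where
  "split_sum c f w = (\<Sum>p\<leftarrow>splits_at c w. f (fst p) (snd p))"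

lemma split_sum_Nil [simp]: "split_sum c f [] = 0"
  by (simp add: split_sum_def)

lemma split_sum_Cons: "split_sum c f (x # w) = (if x = c then f [] w else 0) + split_sum c (\<lambda>u. f (x # u)) w"
  by (simp add: split_sum_def o_def case_prod_beta)

lemma split_sum_other:
  "c \<noteq> c' \<Longrightarrow> split_sum c f (replicate n c' @ w) = split_sum c (\<lambda>u. f (replicate n c' @ u)) w"
  by (simp add: split_sum_def splits_at_append splits_at_replicate_other o_def)

text \<open>If a summand vanishes whenever the remainder starts with another \<open>Star\<close>, only the last letter of a
  block of stars contributes. This turns sums over positions into sums over blocks.\<close>
lemma split_sum_Star_block:
  assumes "\<And>u v. f u (Star # v) = 0"
  shows "split_sum Star f (replicate n Star @ w) =
    (if n = 0 then 0 else f (replicate (n - 1) Star) w) + split_sum Star (\<lambda>u. f (replicate n Star @ u)) w"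
  using assms
proof (induction n arbitrary: f)
  case (Suc n)
  have "split_sum Star (\<lambda>u. f (Star # u)) (replicate n Star @ w) =
    (if n = 0 then 0 else f (Star # replicate (n - 1) Star) w) + split_sum Star (\<lambda>u. f (Star # replicate n Star @ u)) w"
    using Suc.IH[of "\<lambda>u. f (Star # u)"] Suc.prems by simp
  then show ?case using Suc.prems by (cases n) (simp_all add: split_sum_Cons)
qed simp

lemma split_sum_Plain_block:
  assumes "\<And>u v. f (u @ [Plain]) v = 0"
  shows "split_sum Plain f (replicate n Plain @ w) =
    (if n = 0 then 0 else f [] (replicate (n - 1) Plain @ w)) + split_sum Plain (\<lambda>u. f (replicate n Plain @ u)) w"
  using assms
proof (induction n arbitrary: f)
  case (Suc n)
  have f0: "f [Plain] v = 0" for v using Suc.prems[of "[]"] by simp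
  have "f (Plain # u @ [Plain]) v = 0" for u v using Suc.prems[of "Plain # u"] by simp
  then have "split_sum Plain (\<lambda>u. f (Plain # u)) (replicate n Plain @ w) =
    split_sum Plain (\<lambda>u. f (Plain # replicate n Plain @ u)) w"
    using Suc.IH[of "\<lambda>u. f (Plain # u)"] f0 by simp
  then show ?case by (simp add: split_sum_Cons)
qed simp

text \<open>What the combinatorics needs to know about the limit moments: they are tracial, and exchanging
  \<open>T\<close> and \<open>T\<^sup>*\<close> does not change them.\<close>
locale alternating_word =
  fixes t :: "word \<Rightarrow> complex" and k l :: "nat \<Rightarrow> nat"
  assumes t_cyclic: "t (u @ v) = t (v @ u)"
    and t_flip: "t (map flip w) = t w"
begin

definition stretch :: "nat \<Rightarrow> nat \<Rightarrow> word" where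
  "stretch a b = concat (map (\<lambda>s. replicate (k s) Star @ replicate (l s) Plain) [a..<b])"

lemma stretch_self [simp]: "stretch a a = []"
  by (simp add: stretch_def)

lemma stretch_Suc: "a < b \<Longrightarrow> stretch a b = replicate (k a) Star @ replicate (l a) Plain @ stretch (Suc a) b"
  by (simp add: stretch_def upt_conv_Cons)

lemma stretch_last: "a \<le> b \<Longrightarrow> stretch a (Suc b) = stretch a b @ replicate (k b) Star @ replicate (l b) Plain"
  by (simp add: stretch_def)

text \<open>The part of the word between the gap after \<open>(T\<^sup>*)\<^sup>k\<close> in block \<open>a\<close> and the gap in block \<open>b\<close>.\<close>
definition between :: "nat \<Rightarrow> nat \<Rightarrow> word" where
  "between a b = (if a = b then [] else replicate (l a) Plain @ stretch (Suc a) b @ replicate (k b) Star)"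

lemma between_self [simp]: "between a a = []"
  by (simp add: between_def)

lemma stretch_between: "a \<le> b \<Longrightarrow> stretch a b @ replicate (k b) Star = replicate (k a) Star @ between a b"
  by (cases "a = b") (simp_all add: between_def stretch_Suc)

text \<open>A return to the least vertex ends a block of stars, and what follows is read from that gap.\<close>
lemma split_sum_stretch_Star:
  assumes "\<And>u v. f u (Star # v) = 0" "a \<le> b"
  shows "split_sum Star f (stretch a b @ replicate (k b) Star) =
    (\<Sum>c=a..b. if k c = 0 then 0 else f (stretch a c @ replicate (k c - 1) Star) (between c b))"
  using assms(2,1)
proof (induction a arbitrary: f rule: inc_induct)
  case base
  then show ?case
    using split_sum_Star_block[of f "k b" "[]"] by simp
next
  case (step a)
  let ?X = "stretch (Suc a) b @ replicate (k b) Star"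
  let ?P = "replicate (k a) Star @ replicate (l a) Plain"
  have "split_sum Star f (stretch a b @ replicate (k b) Star) =
     (if k a = 0 then 0 else f (replicate (k a - 1) Star) (replicate (l a) Plain @ ?X)) +
     split_sum Star (\<lambda>u. f (?P @ u)) ?X"
    using step.hyps step.prems by (simp add: stretch_Suc split_sum_Star_block split_sum_other)
  also have "split_sum Star (\<lambda>u. f (?P @ u)) ?X =
    (\<Sum>c=Suc a..b. if k c = 0 then 0 else f (?P @ stretch (Suc a) c @ replicate (k c - 1) Star) (between c b))"
    using step.IH[of "\<lambda>u. f (?P @ u)"] step.prems by simp
  also have "\<dots> = (\<Sum>c=Suc a..b. if k c = 0 then 0 else f (stretch a c @ replicate (k c - 1) Star) (between c b))"
    by (intro sum.cong refl) (simp add: stretch_Suc[of a])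
  also have "replicate (l a) Plain @ ?X = between a b" using step.hyps by (simp add: between_def)
  finally show ?case using step.hyps by (simp add: sum.atLeast_Suc_atMost)
qed

lemma split_sum_stretch_Plain:
  assumes "\<And>u v. f (u @ [Plain]) v = 0" "a \<le> b"
  shows "split_sum Plain f (stretch a b) =
    (\<Sum>c=a..<b. if l c = 0 then 0 else f (stretch a c @ replicate (k c) Star)
        (replicate (l c - 1) Plain @ stretch (Suc c) b))"
  using assms(2,1)
proof (induction a arbitrary: f rule: inc_induct)
  case (step a)
  let ?P = "replicate (k a) Star @ replicate (l a) Plain"
  have vanish: "f (x @ u @ [Plain]) v = 0" for x u v using step.prems[of "x @ u"] by simp
  have "split_sum Plain f (stretch a b) =
     (if l a = 0 then 0 else f (replicate (k a) Star) (replicate (l a - 1) Plain @ stretch (Suc a) b)) +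
     split_sum Plain (\<lambda>u. f (?P @ u)) (stretch (Suc a) b)"
    using step.hyps vanish by (simp add: stretch_Suc split_sum_other split_sum_Plain_block)
  also have "split_sum Plain (\<lambda>u. f (?P @ u)) (stretch (Suc a) b) =
    (\<Sum>c=Suc a..<b. if l c = 0 then 0 else f (?P @ stretch (Suc a) c @ replicate (k c) Star)
        (replicate (l c - 1) Plain @ stretch (Suc c) b))"
    using step.IH[of "\<lambda>u. f (?P @ u)"] vanish[of ?P] by simp
  also have "\<dots> = (\<Sum>c=Suc a..<b. if l c = 0 then 0 else f (stretch a c @ replicate (k c) Star)
        (replicate (l c - 1) Plain @ stretch (Suc c) b))"
    by (intro sum.cong refl) (simp add: stretch_Suc[of a])
  finally show ?case using step.hyps by (simp add: sum.atLeast_Suc_lessThan)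
qed simp

definition return_sum :: "word \<Rightarrow> complex" where
  "return_sum w = (\<Sum>us\<leftarrow>returns w. \<Prod>u\<leftarrow>us. t u)"

lemma return_sum_simps:
  "return_sum [] = 1" "return_sum (Star # w) = 0"
  "return_sum (Plain # w) = split_sum Star (\<lambda>u v. t u * return_sum v) w"
  by (simp_all add: return_sum_def split_sum_def sum_list_concat_map o_def sum_list_const_mult)

lemma return_sum_ends_Plain: "return_sum (w @ [Plain]) = 0"
proof (induction w rule: length_induct)
  case (1 w)
  show ?case
  proof (cases w)
    case (Cons c w')
    show ?thesis
    proof (cases c)
      case Plain
      have "(\<Sum>p\<leftarrow>splits_at Star w'. t (fst p) * return_sum (snd p @ [Plain])) = (\<Sum>p\<leftarrow>splits_at Star w'. 0)"
        by (intro arg_cong[where f = sum_list] map_cong refl)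
           (use 1 splits_at_length Cons in force)
      then show ?thesis
        by (simp add: Cons Plain return_sum_simps split_sum_def splits_at_append o_def)
    qed (simp add: Cons return_sum_simps)
  qed (simp add: return_sum_simps)
qed

text \<open>The limit for the excursion between consecutive visits in the gaps \<open>a\<close> and \<open>b\<close>. The value 1 belongs
  to neighbouring gaps at the same position of the word; it plays the part of \<open>N(-1, -1)\<close>.\<close>
definition excursion :: "nat \<Rightarrow> nat \<Rightarrow> complex" where
  "excursion a b = (if l a \<ge> 1 \<and> k b \<ge> 1
       then t (replicate (l a - 1) Plain @ stretch (Suc a) b @ replicate (k b - 1) Star)
     else if b = Suc a \<and> l a = 0 \<and> k b = 0 then 1 else 0)"

text \<open>Decomposition by the next visited gap \<open>c\<close>. If \<open>l a = 0\<close>, gap \<open>a\<close> either coincides with the next gap,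
  and then that one has to be visited next, or is followed by a \<open>Star\<close> and cannot be visited.\<close>
lemma return_sum_between:
  assumes "a < b"
  shows "return_sum (between a b) = (\<Sum>c\<in>{Suc a..b}. excursion a c * return_sum (between c b))"
proof (cases "l a")
  case (Suc l')
  let ?f = "\<lambda>u v. t (replicate l' Plain @ u) * return_sum v"
  have "return_sum (between a b) = split_sum Star ?f (stretch (Suc a) b @ replicate (k b) Star)"
    using assms Suc by (simp add: between_def return_sum_simps split_sum_other)
  also have "\<dots> = (\<Sum>c=Suc a..b. if k c = 0 then 0 else ?f (stretch (Suc a) c @ replicate (k c - 1) Star) (between c b))"
    using assms by (intro split_sum_stretch_Star) (simp_all add: return_sum_simps)
  also have "\<dots> = (\<Sum>c\<in>{Suc a..b}. excursion a c * return_sum (between c b))"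
    using Suc by (intro sum.cong refl) (auto simp: excursion_def)
  finally show ?thesis .
next
  case 0
  have "between a b = replicate (k (Suc a)) Star @ between (Suc a) b"
    using assms 0 stretch_between[of "Suc a" b] by (simp add: between_def)
  then have "return_sum (between a b) = (if k (Suc a) = 0 then return_sum (between (Suc a) b) else 0)"
    by (cases "k (Suc a)") (simp_all add: return_sum_simps)
  moreover have "excursion a c = (if c = Suc a \<and> k (Suc a) = 0 then 1 else 0)" for c
    using 0 by (auto simp: excursion_def)
  then have "(\<Sum>c\<in>{Suc a..b}. excursion a c * return_sum (between c b)) =
      (\<Sum>c\<in>{Suc a..b}. if c = Suc a then (if k (Suc a) = 0 then return_sum (between (Suc a) b) else 0) else 0)"
    by (intro sum.cong refl) auto
  ultimately show ?thesis using assms by simp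
qed

text \<open>The limit for the cyclic excursion from the last visited gap \<open>q\<close> around to the first visited gap
  \<open>p\<close>. It degenerates when the first and the last gap coincide cyclically.\<close>
definition outer :: "nat \<Rightarrow> nat \<Rightarrow> nat \<Rightarrow> complex" where
  "outer n p q = (if k p \<ge> 1 \<and> l q \<ge> 1
       then t (stretch 1 p @ replicate (k p - 1) Star @ replicate (l q - 1) Plain @ stretch (Suc q) (Suc n))
     else if p = 1 \<and> q = n \<and> k p = 0 \<and> l q = 0 then 1 else 0)"

text \<open>Organises the sets of visits by the first gap \<open>p\<close> and the last gap \<open>q\<close>. The walks that start at the
  least vertex are those with the degenerate outer excursion.\<close>
lemma visit_sum_stretch:
  assumes n: "n \<ge> 1"
  shows "visit_sum t (stretch 1 (Suc n)) = (\<Sum>q=1..n. \<Sum>p=1..q. outer n p q * return_sum (between p q))"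
proof -
  let ?w = "stretch 1 (Suc n)"
  let ?g = "\<lambda>y x v. t (y @ x) * return_sum v"
  let ?f = "\<lambda>u y. split_sum Star (?g y) u"
  have g0: "?g y x (Star # v) = 0" for x y v by (simp add: return_sum_simps)
  have inner: "split_sum Star (?g y) (stretch 1 q @ replicate (k q) Star) =
    (\<Sum>p=1..q. if k p = 0 then 0 else ?g y (stretch 1 p @ replicate (k p - 1) Star) (between p q))"
    if "q \<in> {1..n}" for q y
    using that by (intro split_sum_stretch_Star g0) simp
  \<comment> \<open>a walk that starts at the least vertex cannot return there by a \<open>Plain\<close>\<close>
  have f0: "?f (u @ [Plain]) y = 0" for u y
  proof -
    have "(\<Sum>p\<leftarrow>splits_at Star u. t (y @ fst p) * return_sum (snd p @ [Plain])) = (\<Sum>p\<leftarrow>splits_at Star u. 0)"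
      by (simp add: return_sum_ends_Plain)
    then show ?thesis by (simp add: split_sum_def splits_at_append o_def)
  qed
  have vs: "visit_sum t ?w = return_sum ?w + split_sum Plain ?f ?w"
    by (simp add: visit_sum_def visits_def return_sum_def split_sum_def sum_list_concat_map o_def sum_list_const_mult)
  have "split_sum Plain ?f ?w = (\<Sum>q=1..<Suc n. if l q = 0 then 0 else
        split_sum Star (?g (replicate (l q - 1) Plain @ stretch (Suc q) (Suc n))) (stretch 1 q @ replicate (k q) Star))"
    using f0 n by (intro split_sum_stretch_Plain) auto
  also have "\<dots> = (\<Sum>q=1..n. if l q = 0 then 0 else
     (\<Sum>p=1..q. if k p = 0 then 0 else ?g (replicate (l q - 1) Plain @ stretch (Suc q) (Suc n))
         (stretch 1 p @ replicate (k p - 1) Star) (between p q)))"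
    by (intro sum.cong if_cong refl inner) auto
  finally have second: "split_sum Plain ?f ?w = \<dots>" .
  have first: "return_sum ?w = (if k 1 = 0 \<and> l n = 0 then return_sum (between 1 n) else 0)"
  proof (cases "l n")
    case 0
    have "?w = replicate (k 1) Star @ between 1 n"
      using n 0 stretch_between[of 1 n] by (simp add: stretch_last)
    then show ?thesis using 0 by (cases "k 1") (simp_all add: return_sum_simps)
  next
    case (Suc m)
    then have "?w = (stretch 1 n @ replicate (k n) Star @ replicate m Plain) @ [Plain]"
      using n by (simp add: stretch_last replicate_append_same)
    then have "return_sum ?w = 0" by (simp only: return_sum_ends_Plain)
    then show ?thesis using Suc by simp
  qed
  have cyc: "?g (y1 @ y2) (x1 @ x2) v = t (x1 @ x2 @ y1 @ y2) * return_sum v" for x1 x2 y1 y2 v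
    using t_cyclic[of "y1 @ y2" "x1 @ x2"] by simp
  have "(\<Sum>q=1..n. \<Sum>p=1..q. outer n p q * return_sum (between p q)) =
    (\<Sum>q=1..n. \<Sum>p=1..q. (if p = 1 then (if q = n then (if k 1 = 0 \<and> l n = 0 then return_sum (between 1 n) else 0) else 0) else 0) +
      (if l q = 0 \<or> k p = 0 then 0 else ?g (replicate (l q - 1) Plain @ stretch (Suc q) (Suc n))
         (stretch 1 p @ replicate (k p - 1) Star) (between p q)))"
    unfolding cyc by (intro sum.cong refl) (auto simp: outer_def)
  also have "\<dots> = (\<Sum>q=1..n. (if q = n then (if k 1 = 0 \<and> l n = 0 then return_sum (between 1 n) else 0) else 0)) +
     (\<Sum>q=1..n. \<Sum>p=1..q. (if l q = 0 \<or> k p = 0 then 0 else ?g (replicate (l q - 1) Plain @ stretch (Suc q) (Suc n))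
         (stretch 1 p @ replicate (k p - 1) Star) (between p q)))"
    unfolding sum.distrib by (intro arg_cong2[where f = "(+)"] sum.cong refl) (auto simp: sum.delta)
  also have "(\<Sum>q=1..n. (if q = n then (if k 1 = 0 \<and> l n = 0 then return_sum (between 1 n) else 0) else 0)) = return_sum ?w"
    using n unfolding first by (simp add: sum.delta)
  also have "(\<Sum>q=1..n. \<Sum>p=1..q. (if l q = 0 \<or> k p = 0 then 0 else ?g (replicate (l q - 1) Plain @ stretch (Suc q) (Suc n))
         (stretch 1 p @ replicate (k p - 1) Star) (between p q))) = split_sum Plain ?f ?w"
    unfolding second by (intro sum.cong refl) auto
  finally show ?thesis unfolding vs by (rule sym)
qed

end


section \<open>Sums over increasing maps\<close>

text \<open>The sum over chains \<open>p < \<dots> < q\<close> with \<open>r\<close> steps, that is, a power of the strictly upper triangular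
  part of \<open>G\<close>. Increasing maps grow at their last argument and returns at their first excursion, so
  both recursions are needed: the last step is split off here, the first one in \<open>chain_first_step\<close>.\<close>
primrec chain :: "nat \<Rightarrow> (nat \<Rightarrow> nat \<Rightarrow> 'a::comm_semiring_1) \<Rightarrow> nat \<Rightarrow> nat \<Rightarrow> nat \<Rightarrow> 'a" where
  "chain n G 0 p q = (if p = q then 1 else 0)"
| "chain n G (Suc r) p q = (\<Sum>c=1..n. chain n G r p c * (if c < q then G c q else 0))"

lemma chain_first_step:
  assumes "p \<in> {1..n}" "q \<in> {1..n}"
  shows "chain n G (Suc r) p q = (\<Sum>e=1..n. (if p < e then G p e else 0) * chain n G r e q)"
  using assms(2)
proof (induction r arbitrary: q)
  case 0
  have "(\<Sum>c=1..n. chain n G 0 p c * (if c < q then G c q else 0)) = (\<Sum>c=1..n. if p = c then (if p < q then G p q else 0) else 0)"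
    by (intro sum.cong) auto
  moreover have "(\<Sum>e=1..n. (if p < e then G p e else 0) * chain n G 0 e q) = (\<Sum>e=1..n. if e = q then (if p < q then G p q else 0) else 0)"
    by (intro sum.cong) auto
  ultimately show ?case using assms(1) 0 by simp
next
  case (Suc r)
  have "chain n G (Suc (Suc r)) p q =
    (\<Sum>c=1..n. (\<Sum>e=1..n. (if p < e then G p e else 0) * chain n G r e c) * (if c < q then G c q else 0))"
    unfolding chain.simps(2)[of n G "Suc r"] using Suc.IH by (intro sum.cong refl) simp
  also have "\<dots> = (\<Sum>c=1..n. \<Sum>e=1..n. (if p < e then G p e else 0) * (chain n G r e c * (if c < q then G c q else 0)))"
    by (simp only: sum_distrib_right mult.assoc)
  also have "\<dots> = (\<Sum>e=1..n. \<Sum>c=1..n. (if p < e then G p e else 0) * (chain n G r e c * (if c < q then G c q else 0)))"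
    by (rule sum.swap)
  finally show ?case by (simp only: chain.simps(2) sum_distrib_left)
qed

lemma chain_decreasing: "q < p \<Longrightarrow> chain n G r p q = 0"
proof (induction r arbitrary: q)
  case (Suc r)
  have "chain n G r p c * (if c < q then G c q else 0) = 0" for c
    using Suc by (cases "c < q") auto
  then show ?case by (simp only: chain.simps sum.neutral_const)
qed simp

abbreviation increasing_maps :: "nat \<Rightarrow> nat \<Rightarrow> (nat \<Rightarrow> nat) set" where
  "increasing_maps r n \<equiv> {j \<in> {1..r} \<rightarrow>\<^sub>E {1..n}. strict_mono_on {1..r} j}"

lemma finite_increasing_maps: "finite (increasing_maps r n)"
  by (rule finite_subset[OF _ finite_PiE[of "{1..r}" "\<lambda>_. {1..n}"]]) auto

text \<open>An increasing map on \<open>{1..s + 1}\<close> is one on \<open>{1..s}\<close> together with a larger last value.\<close>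
lemma sum_increasing_maps_Suc:
  assumes "s \<ge> 1"
  shows "(\<Sum>j\<in>increasing_maps (Suc s) n. F j) =
    (\<Sum>j\<in>increasing_maps s n. \<Sum>q=1..n. if j s < q then F (j(Suc s := q)) else 0)"
proof -
  have "(\<Sum>j\<in>increasing_maps s n. \<Sum>q=1..n. if j s < q then F (j(Suc s := q)) else 0) =
    (\<Sum>(j, q)\<in>increasing_maps s n \<times> {1..n}. if j s < q then F (j(Suc s := q)) else 0)"
    by (rule sum.cartesian_product)
  also have "\<dots> = (\<Sum>(j, q)\<in>{(j, q) \<in> increasing_maps s n \<times> {1..n}. j s < q}. F (j(Suc s := q)))"
    by (rule sum.mono_neutral_cong_right[OF finite_cartesian_product[OF finite_increasing_maps finite_atLeastAtMost]])
       (auto split: if_splits)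
  also have "\<dots> = (\<Sum>j\<in>increasing_maps (Suc s) n. F j)"
  proof (rule sum.reindex_bij_witness[where i = "\<lambda>j. (restrict j {1..s}, j (Suc s))" and j = "\<lambda>(j, q). j(Suc s := q)"], goal_cases)
    case (1 a)
    then show ?case by (auto simp: PiE_def extensional_def restrict_def fun_eq_iff)
  next
    case (2 a)
    obtain j q where a: "a = (j, q)" by (cases a)
    have j: "j \<in> {1..s} \<rightarrow>\<^sub>E {1..n}" "strict_mono_on {1..s} j" "q \<in> {1..n}" "j s < q" using 2 a by auto
    have "j x < q" if "x \<in> {1..s}" for x
      using strict_mono_onD[OF j(2) that, of s] that j(4) assms by (cases "x = s") auto
    then have "strict_mono_on {1..Suc s} (j(Suc s := q))"
      using strict_mono_onD[OF j(2)] by (intro strict_mono_onI) (auto simp: le_Suc_eq)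
    moreover have "j(Suc s := q) \<in> {1..Suc s} \<rightarrow>\<^sub>E {1..n}"
      using j by (auto simp: PiE_def extensional_def Pi_def le_Suc_eq)
    ultimately show ?case by (simp add: a)
  next
    case (3 j)
    then show ?case by (auto simp: PiE_def extensional_def fun_eq_iff le_Suc_eq)
  next
    case (4 j)
    then have j: "j \<in> {1..Suc s} \<rightarrow>\<^sub>E {1..n}" "strict_mono_on {1..Suc s} j" by auto
    have "restrict j {1..s} \<in> {1..s} \<rightarrow>\<^sub>E {1..n}" using j(1) by (auto simp: PiE_def Pi_def)
    moreover have "strict_mono_on {1..s} (restrict j {1..s})"
      using strict_mono_onD[OF j(2)] by (intro strict_mono_onI) auto
    moreover have "restrict j {1..s} s < j (Suc s)"
      using strict_mono_onD[OF j(2), of s "Suc s"] assms by simp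
    moreover have "j (Suc s) \<in> {1..n}" using j(1) by auto
    ultimately show ?case by simp
  qed auto
  finally show ?thesis by simp
qed

lemma sum_increasing_maps_chain:
  "(\<Sum>j\<in>increasing_maps (Suc r) n. f (j 1) (j (Suc r)) * (\<Prod>i\<in>{1..<Suc r}. G (j i) (j (Suc i)))) =
   (\<Sum>p=1..n. \<Sum>q=1..n. f p q * chain n G r p q)"
proof (induction r arbitrary: f)
  case 0
  have "(\<Sum>j\<in>increasing_maps (Suc 0) n. f (j 1) (j 1)) = (\<Sum>p=1..n. f p p)"
  proof (rule sum.reindex_bij_witness[where i = "\<lambda>p. (\<lambda>i. undefined)(Suc 0 := p)" and j = "\<lambda>j. j 1"])
    fix j assume "j \<in> increasing_maps (Suc 0) n"
    then have j: "j \<in> {Suc 0} \<rightarrow>\<^sub>E {1..n}" by simp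
    show "(\<lambda>i. undefined)(Suc 0 := j 1) = j"
    proof
      fix x show "((\<lambda>i. undefined)(Suc 0 := j 1)) x = j x"
        using PiE_arb[OF j, of x] by (cases "x = Suc 0") auto
    qed
    show "j 1 \<in> {1..n}" using PiE_mem[OF j, of "Suc 0"] by simp
    show "f (j 1) (j 1) = f (j 1) (j 1)" ..
  next
    fix p assume p: "p \<in> {1..n}"
    show "((\<lambda>i. undefined)(Suc 0 := p)) 1 = p" by simp
    have "(\<lambda>i. undefined)(Suc 0 := p) \<in> {1..Suc 0} \<rightarrow>\<^sub>E {1..n}"
      by (rule PiE_I) (use p in auto)
    moreover have "strict_mono_on {1..Suc 0} ((\<lambda>i. undefined)(Suc 0 := p))"
      by (rule strict_mono_onI) simp
    ultimately show "(\<lambda>i. undefined)(Suc 0 := p) \<in> increasing_maps (Suc 0) n" by simp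
  qed
  moreover have "(\<Sum>q=1..n. f p q * chain n G 0 p q) = f p p" if "p \<in> {1..n}" for p
  proof -
    have "(\<Sum>q=1..n. f p q * chain n G 0 p q) = (\<Sum>q=1..n. if p = q then f p p else 0)"
      by (intro sum.cong) auto
    then show ?thesis using that by simp
  qed
  ultimately show ?case by simp
next
  case (Suc r)
  let ?s = "Suc r"
  let ?h = "\<lambda>p c. \<Sum>q=1..n. f p q * (if c < q then G c q else 0)"
  have "(\<Sum>j\<in>increasing_maps (Suc ?s) n. f (j 1) (j (Suc ?s)) * (\<Prod>i\<in>{1..<Suc ?s}. G (j i) (j (Suc i)))) =
    (\<Sum>j\<in>increasing_maps ?s n. \<Sum>q=1..n. if j ?s < q then
       f (j 1) q * ((\<Prod>i\<in>{1..<?s}. G (j i) (j (Suc i))) * G (j ?s) q) else 0)"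
  proof -
    have last: "(\<Prod>i\<in>{1..<Suc ?s}. G ((j(Suc ?s := q)) i) ((j(Suc ?s := q)) (Suc i))) =
      (\<Prod>i\<in>{1..<?s}. G (j i) (j (Suc i))) * G (j ?s) q" for j q
    proof -
      have "(\<Prod>i\<in>{1..<?s}. G ((j(Suc ?s := q)) i) ((j(Suc ?s := q)) (Suc i))) = (\<Prod>i\<in>{1..<?s}. G (j i) (j (Suc i)))"
        by (rule prod.cong) auto
      then show ?thesis by (simp add: prod.atLeastLessThan_Suc)
    qed
    show ?thesis
      by (subst sum_increasing_maps_Suc, simp, intro sum.cong refl if_cong, unfold last) simp
  qed
  also have "\<dots> = (\<Sum>j\<in>increasing_maps ?s n. ?h (j 1) (j ?s) * (\<Prod>i\<in>{1..<?s}. G (j i) (j (Suc i))))"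
    by (rule sum.cong[OF refl], unfold sum_distrib_right, rule sum.cong[OF refl]) (simp add: mult_ac)
  also have "\<dots> = (\<Sum>p=1..n. \<Sum>c=1..n. ?h p c * chain n G r p c)"
    by (rule Suc.IH)
  also have "\<dots> = (\<Sum>p=1..n. \<Sum>c=1..n. \<Sum>q=1..n. f p q * (chain n G r p c * (if c < q then G c q else 0)))"
    unfolding sum_distrib_right by (intro sum.cong refl) (simp add: mult_ac)
  also have "\<dots> = (\<Sum>p=1..n. \<Sum>q=1..n. \<Sum>c=1..n. f p q * (chain n G r p c * (if c < q then G c q else 0)))"
    by (rule sum.cong[OF refl], rule sum.swap)
  also have "\<dots> = (\<Sum>p=1..n. \<Sum>q=1..n. f p q * chain n G (Suc r) p q)"
    by (simp only: chain.simps sum_distrib_left)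
  finally show ?case .
qed

context alternating_word begin

text \<open>A chain from \<open>p\<close> to \<open>q\<close> has at most \<open>q - p\<close> steps, so the sum over \<open>r\<close> is complete as soon as \<open>N\<close>
  exceeds this number.\<close>
lemma sum_chain_return_sum:
  assumes "p \<in> {1..n}" "q \<in> {1..n}" "p \<le> q" "q - p < N"
  shows "(\<Sum>r<N. chain n excursion r p q) = return_sum (between p q)"
  using assms
proof (induction N arbitrary: p)
  case (Suc N)
  have "(\<Sum>r<Suc N. chain n excursion r p q) = chain n excursion 0 p q + (\<Sum>r<N. chain n excursion (Suc r) p q)"
    by (simp only: sum.lessThan_Suc_shift)
  also have "(\<Sum>r<N. chain n excursion (Suc r) p q) =
     (\<Sum>r<N. \<Sum>e=1..n. (if p < e then excursion p e else 0) * chain n excursion r e q)"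
    by (intro sum.cong refl chain_first_step) (use Suc.prems in auto)
  also have "\<dots> = (\<Sum>e=1..n. (if p < e then excursion p e else 0) * (\<Sum>r<N. chain n excursion r e q))"
    by (subst sum.swap) (simp only: sum_distrib_left)
  also have "\<dots> = (\<Sum>e=1..n. if e \<in> {Suc p..q} then excursion p e * return_sum (between e q) else 0)"
  proof (intro sum.cong refl)
    fix e assume e: "e \<in> {1..n}"
    show "(if p < e then excursion p e else 0) * (\<Sum>r<N. chain n excursion r e q) =
      (if e \<in> {Suc p..q} then excursion p e * return_sum (between e q) else 0)"
      using Suc.IH[of e] Suc.prems e by (auto simp: chain_decreasing)
  qed
  also have "\<dots> = (\<Sum>e\<in>{Suc p..q}. excursion p e * return_sum (between e q))"
    by (rule sum.mono_neutral_cong_right) (use Suc.prems in auto)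
  finally show ?case
    using Suc.prems return_sum_between[of p q] by (cases "p = q") (auto simp: return_sum_simps)
qed simp

theorem visit_sum_increasing_maps:
  assumes n: "n \<ge> 1"
  shows "visit_sum t (stretch 1 (Suc n)) =
    (\<Sum>r=1..n. \<Sum>j\<in>increasing_maps r n. outer n (j 1) (j r) * (\<Prod>i\<in>{1..<r}. excursion (j i) (j (i + 1))))"
proof -
  have "(\<Sum>r=1..n. \<Sum>j\<in>increasing_maps r n. outer n (j 1) (j r) * (\<Prod>i\<in>{1..<r}. excursion (j i) (j (i + 1)))) =
    (\<Sum>r<n. \<Sum>j\<in>increasing_maps (Suc r) n. outer n (j 1) (j (Suc r)) * (\<Prod>i\<in>{1..<Suc r}. excursion (j i) (j (Suc i))))"
    by (rule sum.reindex_bij_witness[where i = Suc and j = "\<lambda>r. r - 1"]) auto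
  also have "\<dots> = (\<Sum>r<n. \<Sum>p=1..n. \<Sum>q=1..n. outer n p q * chain n excursion r p q)"
    by (simp only: sum_increasing_maps_chain)
  also have "\<dots> = (\<Sum>p=1..n. \<Sum>r<n. \<Sum>q=1..n. outer n p q * chain n excursion r p q)"
    by (rule sum.swap)
  also have "\<dots> = (\<Sum>p=1..n. \<Sum>q=1..n. outer n p q * (\<Sum>r<n. chain n excursion r p q))"
    unfolding sum_distrib_left by (rule sum.cong[OF refl], rule sum.swap)
  also have "\<dots> = (\<Sum>q=1..n. \<Sum>p=1..n. outer n p q * (\<Sum>r<n. chain n excursion r p q))"
    by (rule sum.swap)
  also have "\<dots> = (\<Sum>q=1..n. \<Sum>p=1..q. outer n p q * return_sum (between p q))"
  proof (rule sum.cong[OF refl])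
    fix q assume q: "q \<in> {1..n}"
    show "(\<Sum>p=1..n. outer n p q * (\<Sum>r<n. chain n excursion r p q)) = (\<Sum>p=1..q. outer n p q * return_sum (between p q))"
      by (rule sum.mono_neutral_cong_right) (use q in \<open>auto simp: chain_decreasing sum_chain_return_sum\<close>)
  qed
  finally show ?thesis using visit_sum_stretch[OF n] by simp
qed

end


section \<open>The numbers N and the recursion\<close>

lemma limit_moments_alternating:
  assumes "limit_moments t" shows "alternating_word t"
proof
  show "t (u @ v) = t (v @ u)" for u v
    by (rule limit_moments_eq[OF assms]) (auto intro: trace_moment_rotate)
  show "t (map flip w) = t w" for w
    by (rule limit_moments_eq[OF assms]) (use trace_moment_flip[of _ "[w]"] in auto)
qed

text \<open>The number \<open>N\<close> divided by the factorial of the number of vertices of its tree; the value at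
  \<open>(-1, -1)\<close> belongs to the empty tree.\<close>
definition pair_value :: "(word \<Rightarrow> complex) \<Rightarrow> (int \<times> int) list \<Rightarrow> complex" where
  "pair_value t ps = (if \<forall>(k, l)\<in>set ps. k \<ge> 0 \<and> l \<ge> 0 then t (alt_word ps)
     else if ps = [(-1, -1)] then 1 else 0)"

lemma excess_alt_word:
  "\<forall>(k, l)\<in>set ps. k \<ge> 0 \<and> l \<ge> 0 \<Longrightarrow> excess (alt_word ps) = sum_list (map snd ps) - sum_list (map fst ps)"
  by (induction ps) (auto simp: alt_word_def excess_replicate)

text \<open>The number of vertices may be computed from either family of exponents, since both sides vanish
  when the two sums differ.\<close>
lemma DT_N_pair_value:
  assumes t: "limit_moments (\<lambda>w. \<tau> (op_word T w))"
    and b: "int b = sum_list (map fst (pair_up xs)) + 1 \<or> int b = sum_list (map snd (pair_up xs)) + 1"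
  shows "DT_N T \<tau> xs = fact b * pair_value (\<lambda>w. \<tau> (op_word T w)) (pair_up xs)"
proof -
  let ?ps = "pair_up xs"
  let ?nonneg = "\<forall>(k, l)\<in>set ?ps. k \<ge> 0 \<and> l \<ge> 0"
  show ?thesis
  proof (cases "sum_list (map fst ?ps) = sum_list (map snd ?ps)")
    case True
    then have b': "int b = sum_list (map fst ?ps) + 1" using b by auto
    show ?thesis
    proof (cases ?nonneg)
      case nonneg: True
      have "sum_list (map fst ?ps) \<ge> 0" by (rule sum_list_nonneg) (use nonneg in auto)
      then have "b = nat (sum_list (map fst ?ps)) + 1" using b' by linarith
      then show ?thesis using True nonneg by (simp add: DT_N_def pair_value_def Let_def)
    next
      case False
      then show ?thesis using True b' by (auto simp: DT_N_def pair_value_def Let_def)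
    qed
  next
    case False
    have "\<tau> (op_word T (alt_word ?ps)) = 0" if ?nonneg
      by (rule visit_sum_unbalanced[where t = "\<lambda>w. \<tau> (op_word T w)", OF limit_moments_visit_sum[OF t]])
         (use that False excess_alt_word in auto)
    then show ?thesis using False by (auto simp: DT_N_def pair_value_def Let_def)
  qed
qed

lemma pair_up_alternate:
  "pair_up (alternate k l a b @ ys) = map (\<lambda>s. (int (k s), int (l s))) [a..<b] @ pair_up ys"
proof -
  have "pair_up (concat (map (\<lambda>s. [int (k s), int (l s)]) ss) @ ys) =
    map (\<lambda>s. (int (k s), int (l s))) ss @ pair_up ys" for ss
    by (induction ss) auto
  then show ?thesis by (simp add: alternate_def)
qed

text \<open>The pairs that a factor of the product over \<open>i\<close> consists of: the exponents are paired with an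
  offset, \<open>l s\<close> with the \<open>k\<close> of the following block.\<close>
fun shifted_pairs :: "(nat \<Rightarrow> nat) \<Rightarrow> (nat \<Rightarrow> nat) \<Rightarrow> int \<Rightarrow> nat list \<Rightarrow> int \<Rightarrow> (int \<times> int) list" where
  "shifted_pairs k l x [] y = [(x, y)]"
| "shifted_pairs k l x (s # ss) y = (x, int (k s)) # shifted_pairs k l (int (l s)) ss y"

lemma pair_up_shifted:
  "pair_up ([x] @ alternate k l a b @ [y]) = shifted_pairs k l x [a..<b] y"
proof -
  have "pair_up (x # concat (map (\<lambda>s. [int (k s), int (l s)]) ss) @ [y]) = shifted_pairs k l x ss y" for x ss
    by (induction ss arbitrary: x) auto
  then show ?thesis by (simp add: alternate_def)
qed

lemma sum_fst_shifted: "sum_list (map fst (shifted_pairs k l x ss y)) = x + int (\<Sum>s\<leftarrow>ss. l s)"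
  by (induction ss arbitrary: x) auto

lemma shifted_nonneg: "(\<forall>(k, l)\<in>set (shifted_pairs k l x ss y). k \<ge> 0 \<and> l \<ge> 0) \<longleftrightarrow> x \<ge> 0 \<and> y \<ge> 0"
  by (induction ss arbitrary: x) auto

lemma shifted_single: "shifted_pairs k l x ss y = [(-1, -1)] \<longleftrightarrow> ss = [] \<and> x = -1 \<and> y = -1"
proof (cases ss)
  case (Cons s ss')
  then show ?thesis by (cases ss') auto
qed auto

text \<open>In these factors the \<open>l\<close> are exponents of \<open>T\<^sup>*\<close> and the \<open>k\<close> those of \<open>T\<close>; after exchanging the letters
  the word is the excursion itself.\<close>
lemma flip_alt_word_shifted:
  "map flip (alt_word (shifted_pairs k l x ss y)) = replicate (nat x) Plain @
     concat (map (\<lambda>s. replicate (k s) Star @ replicate (l s) Plain) ss) @ replicate (nat y) Star"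
  by (induction ss arbitrary: x) (auto simp: alt_word_def)

lemma nat_int_minus_1: "nat (int m - 1) = m - 1"
  by arith

lemma prod_fact_dvd: "prod_list (map fact bs) dvd (fact (sum_list bs) :: nat)"
proof (induction bs)
  case (Cons b bs)
  have "fact b * prod_list (map fact bs) dvd fact b * (fact (sum_list bs) :: nat)"
    using Cons by (rule mult_dvd_mono[OF dvd_refl])
  also have "\<dots> dvd fact (b + sum_list bs)" by (rule fact_fact_dvd_fact)
  finally show ?case by simp
qed simp

lemma multinomial_mult: "multinomial (sum_list bs) bs * prod_list (map fact bs) = fact (sum_list bs)"
  using prod_fact_dvd by (simp add: multinomial_def)

context alternating_word begin

lemma pair_value_excursion:
  assumes "a < b"
  shows "pair_value t (shifted_pairs k l (int (l a) - 1) [a + 1..<b] (int (k b) - 1)) = excursion a b"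
proof -
  let ?ps = "shifted_pairs k l (int (l a) - 1) [a + 1..<b] (int (k b) - 1)"
  have "t (alt_word ?ps) = t (replicate (l a - 1) Plain @ stretch (Suc a) b @ replicate (k b - 1) Star)"
    unfolding t_flip[of "alt_word ?ps", symmetric] flip_alt_word_shifted stretch_def
    by (simp add: nat_int_minus_1)
  then show ?thesis
    unfolding pair_value_def excursion_def shifted_nonneg shifted_single using assms
    by (cases "b = Suc a") auto
qed

lemma pair_value_outer:
  assumes "1 \<le> p" "p \<le> q" "q \<le> n"
  shows "pair_value t (map (\<lambda>s. (int (k s), int (l s))) [1..<p] @ (int (k p) - 1, int (l q) - 1) #
     map (\<lambda>s. (int (k s), int (l s))) [q + 1..<n + 1]) = outer n p q"
proof -
  let ?ps = "map (\<lambda>s. (int (k s), int (l s))) [1..<p] @ (int (k p) - 1, int (l q) - 1) #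
     map (\<lambda>s. (int (k s), int (l s))) [q + 1..<n + 1]"
  have "(\<forall>(k, l)\<in>set ?ps. k \<ge> 0 \<and> l \<ge> 0) \<longleftrightarrow> k p \<ge> 1 \<and> l q \<ge> 1" by auto
  moreover have "?ps = [(-1, -1)] \<longleftrightarrow> p = 1 \<and> q = n \<and> k p = 0 \<and> l q = 0"
    using assms by (auto simp: append_eq_Cons_conv)
  moreover have "alt_word ?ps = stretch 1 p @ replicate (k p - 1) Star @ replicate (l q - 1) Plain @ stretch (Suc q) (Suc n)"
    by (simp add: alt_word_def stretch_def o_def nat_int_minus_1)
  ultimately show ?thesis by (simp only: pair_value_def outer_def)
qed

lemma alt_word_stretch: "alt_word (map (\<lambda>s. (int (k s), int (l s))) [a..<b]) = stretch a b"
  by (simp add: alt_word_def stretch_def o_def)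

lemma length_stretch: "length (stretch a b) = (\<Sum>s=a..<b. k s) + (\<Sum>s=a..<b. l s)"
  by (simp add: stretch_def length_concat o_def sum_list_addf interv_sum_list_conv_sum_set_nat)

lemma excess_stretch: "excess (stretch a b) = (\<Sum>s=a..<b. int (l s)) - (\<Sum>s=a..<b. int (k s))"
proof (cases "a \<le> b")
  case True
  then show ?thesis
    by (induction b rule: dec_induct) (simp_all add: stretch_last excess_replicate)
qed (simp add: stretch_def)

end

lemma sum_consecutive_blocks:
  fixes f :: "nat \<Rightarrow> 'a::comm_monoid_add"
  assumes "r \<ge> 1" "\<And>i. i \<in> {1..<r} \<Longrightarrow> j i \<le> j (Suc i)"
  shows "j 1 \<le> j r" "(\<Sum>i\<in>{1..<r}. \<Sum>s\<in>{j i..<j (Suc i)}. f s) = (\<Sum>s\<in>{j 1..<j r}. f s)"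
proof -
  have "j 1 \<le> j r \<and> (\<Sum>i\<in>{1..<r}. \<Sum>s\<in>{j i..<j (Suc i)}. f s) = (\<Sum>s\<in>{j 1..<j r}. f s)"
    using assms
  proof (induction r rule: dec_induct)
    case (step r)
    have "j i \<le> j (Suc i)" if "i \<in> {1..<r}" for i
      by (rule step.prems) (use that in simp)
    from step.IH[OF this]
    have IH: "j 1 \<le> j r" "(\<Sum>i\<in>{1..<r}. \<Sum>s\<in>{j i..<j (Suc i)}. f s) = (\<Sum>s\<in>{j 1..<j r}. f s)"
      by blast+
    have le: "j r \<le> j (Suc r)" by (rule step.prems) (use step.hyps in simp)
    have "(\<Sum>i\<in>{1..<Suc r}. \<Sum>s\<in>{j i..<j (Suc i)}. f s) =
        (\<Sum>s\<in>{j 1..<j r}. f s) + (\<Sum>s\<in>{j r..<j (Suc r)}. f s)"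
      unfolding IH(2)[symmetric] using step.hyps(1) by (rule sum.atLeastLessThan_Suc)
    also have "\<dots> = (\<Sum>s\<in>{j 1..<j (Suc r)}. f s)"
      by (rule sum.atLeastLessThan_concat[OF IH(1) le])
    finally show ?case using order_trans[OF IH(1) le] by blast
  qed simp
  then show "j 1 \<le> j r" "(\<Sum>i\<in>{1..<r}. \<Sum>s\<in>{j i..<j (Suc i)}. f s) = (\<Sum>s\<in>{j 1..<j r}. f s)"
    by blast+
qed

text \<open>The factorials of the tree sizes cancel the denominator of the multinomial coefficient. Its blocks
  exhaust \<open>{1..n}\<close>, so the quotient is exact.\<close>
lemma Nom_mult_facts:
  assumes "j \<in> increasing_maps r n" "r \<ge> 1"
  shows "Nom n l r j * (fact ((\<Sum>s\<in>{1..<j 1}. l s) + (\<Sum>s\<in>{j r..n}. l s)) *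
     (\<Prod>i\<in>{1..<r}. fact (\<Sum>s\<in>{j i..<j (i + 1)}. l s))) = fact (\<Sum>s=1..n. l s)"
proof -
  have j: "j \<in> {1..r} \<rightarrow>\<^sub>E {1..n}" "strict_mono_on {1..r} j" using assms by auto
  have range: "j 1 \<in> {1..n}" "j r \<in> {1..n}" using j(1) assms(2) by auto
  have mono: "j i \<le> j (Suc i)" if "i \<in> {1..<r}" for i
    using strict_mono_onD[OF j(2), of i "Suc i"] that by simp
  have le: "j 1 \<le> j r" and blocks: "(\<Sum>i\<in>{1..<r}. \<Sum>s\<in>{j i..<j (Suc i)}. l s) = (\<Sum>s\<in>{j 1..<j r}. l s)"
    by (rule sum_consecutive_blocks[OF assms(2)], erule mono)+
  define bs where "bs = ((\<Sum>s\<in>{1..<j 1}. l s) + (\<Sum>s\<in>{j r..n}. l s))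
         # map (\<lambda>i. \<Sum>s\<in>{j i..<j (i + 1)}. l s) [1..<r]"
  have "sum_list bs = (\<Sum>s\<in>{1..<j 1}. l s) + (\<Sum>s\<in>{j r..n}. l s) + (\<Sum>i\<in>{1..<r}. \<Sum>s\<in>{j i..<j (Suc i)}. l s)"
    by (simp add: bs_def interv_sum_list_conv_sum_set_nat)
  also have "\<dots> = (\<Sum>s\<in>{1..<j 1}. l s) + (\<Sum>s\<in>{j 1..<j r}. l s) + (\<Sum>s\<in>{j r..<Suc n}. l s)"
    unfolding blocks atLeastLessThanSuc_atLeastAtMost by (simp only: add_ac)
  also have "(\<Sum>s\<in>{1..<j 1}. l s) + (\<Sum>s\<in>{j 1..<j r}. l s) = (\<Sum>s\<in>{1..<j r}. l s)"
    by (rule sum.atLeastLessThan_concat) (use range le in auto)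
  also have "\<dots> + (\<Sum>s\<in>{j r..<Suc n}. l s) = (\<Sum>s\<in>{1..<Suc n}. l s)"
    by (rule sum.atLeastLessThan_concat) (use range in auto)
  also have "\<dots> = (\<Sum>s=1..n. l s)" by (simp only: atLeastLessThanSuc_atLeastAtMost)
  finally have "sum_list bs = (\<Sum>s=1..n. l s)" .
  moreover have "prod_list (map fact bs) = fact ((\<Sum>s\<in>{1..<j 1}. l s) + (\<Sum>s\<in>{j r..n}. l s)) *
     (\<Prod>i\<in>{1..<r}. fact (\<Sum>s\<in>{j i..<j (i + 1)}. l s) :: nat)"
    using prod.distinct_set_conv_list[OF distinct_upt, of "\<lambda>i. fact (\<Sum>s\<in>{j i..<j (i + 1)}. l s) :: nat" 1 r]
    by (simp add: bs_def o_def)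
  ultimately show ?thesis
    using multinomial_mult[of bs] by (simp add: Nom_def bs_def)
qed

theorem theorem2p3:
  fixes T :: "'h::complex_hilbert_space \<Rightarrow>\<^sub>L 'h"
    and \<tau> :: "('h \<Rightarrow>\<^sub>L 'h) \<Rightarrow> complex"
    and n :: nat
    and k l :: "nat \<Rightarrow> nat"
  assumes "quasinilpotent_DT T \<tau>"
    and "n \<ge> 1"
  shows "DT_N T \<tau> (alternate k l 1 (n + 1)) =
    (\<Sum>r=1..n. \<Sum>j\<in>{j \<in> {1..r} \<rightarrow>\<^sub>E {1..n}. strict_mono_on {1..r} j}.
       of_nat (Nom n l r j) *
       (DT_N T \<tau> (alternate k l 1 (j 1)
                   @ [int (k (j 1)) - 1, int (l (j r)) - 1]
                   @ alternate k l (j r + 1) (n + 1)) *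
        (\<Prod>i\<in>{1..<r}.
           DT_N T \<tau> ([int (l (j i)) - 1]
                      @ alternate k l (j i + 1) (j (i + 1))
                      @ [int (k (j (i + 1))) - 1]))))"
proof -
  define t where "t w = \<tau> (op_word T w)" for w
  have t: "limit_moments t" using assms(1) by (simp add: quasinilpotent_DT_def limit_moments_def t_def)
  interpret alternating_word t k l by (rule limit_moments_alternating[OF t])
  note DT_N = DT_N_pair_value[OF t[unfolded t_def], folded t_def]
  define m where "m = (\<Sum>s=1..n. l s)"
  have m: "m = (\<Sum>s=1..<Suc n. l s)" by (simp add: m_def atLeastLessThanSuc_atLeastAtMost)
  have lhs: "DT_N T \<tau> (alternate k l 1 (n + 1)) = fact (m + 1) * t (stretch 1 (Suc n))"
  proof -
    have ps: "pair_up (alternate k l 1 (n + 1)) = map (\<lambda>s. (int (k s), int (l s))) [1..<Suc n]"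
      using pair_up_alternate[of k l 1 "n + 1" "[]"] by simp
    have "int (m + 1) = sum_list (map snd (pair_up (alternate k l 1 (n + 1)))) + 1"
      unfolding ps m by (simp add: o_def interv_sum_list_conv_sum_set_nat del: upt_Suc sum.op_ivl_Suc)
    then have "DT_N T \<tau> (alternate k l 1 (n + 1)) = fact (m + 1) * pair_value t (pair_up (alternate k l 1 (n + 1)))"
      by (intro DT_N disjI2)
    also have "pair_value t (pair_up (alternate k l 1 (n + 1))) = t (stretch 1 (Suc n))"
      unfolding ps by (simp add: pair_value_def alt_word_stretch del: upt_Suc)
    finally show ?thesis .
  qed
  have term_eq: "of_nat (Nom n l r j) *
       (DT_N T \<tau> (alternate k l 1 (j 1)
                   @ [int (k (j 1)) - 1, int (l (j r)) - 1]
                   @ alternate k l (j r + 1) (n + 1)) *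
        (\<Prod>i\<in>{1..<r}.
           DT_N T \<tau> ([int (l (j i)) - 1]
                      @ alternate k l (j i + 1) (j (i + 1))
                      @ [int (k (j (i + 1))) - 1]))) =
     fact m * (outer n (j 1) (j r) * (\<Prod>i\<in>{1..<r}. excursion (j i) (j (i + 1))))"
    if r: "r \<in> {1..n}" and j: "j \<in> increasing_maps r n" for r j
  proof -
    define b0 where "b0 = (\<Sum>s\<in>{1..<j 1}. l s) + (\<Sum>s\<in>{j r..n}. l s)"
    define b where "b i = (\<Sum>s\<in>{j i..<j (i + 1)}. l s)" for i
    have jj: "j \<in> {1..r} \<rightarrow>\<^sub>E {1..n}" "strict_mono_on {1..r} j" using j by auto
    have range: "j 1 \<in> {1..n}" "j r \<in> {1..n}" using jj(1) r by auto
    have less: "j i < j (i + 1)" if "i \<in> {1..<r}" for i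
      using strict_mono_onD[OF jj(2), of i "i + 1"] that by simp
    have le: "j 1 \<le> j r"
      by (rule sum_consecutive_blocks(1)) (use r less in \<open>auto simp: less_imp_le\<close>)
    have first: "DT_N T \<tau> (alternate k l 1 (j 1) @ [int (k (j 1)) - 1, int (l (j r)) - 1]
                   @ alternate k l (j r + 1) (n + 1)) = fact b0 * outer n (j 1) (j r)"
    proof -
      let ?xs = "alternate k l 1 (j 1) @ [int (k (j 1)) - 1, int (l (j r)) - 1] @ alternate k l (j r + 1) (n + 1)"
      have ps: "pair_up ?xs = map (\<lambda>s. (int (k s), int (l s))) [1..<j 1] @ (int (k (j 1)) - 1, int (l (j r)) - 1) #
         map (\<lambda>s. (int (k s), int (l s))) [j r + 1..<n + 1]"
        using pair_up_alternate[of k l "j r + 1" "n + 1" "[]"] by (simp add: pair_up_alternate del: upt_Suc)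
      have "(\<Sum>s\<in>{j r..n}. int (l s)) = int (l (j r)) + (\<Sum>s\<in>{j r + 1..<n + 1}. int (l s))"
        using range by (simp add: sum.atLeast_Suc_atMost atLeastLessThanSuc_atLeastAtMost)
      then have "int b0 = sum_list (map snd (pair_up ?xs)) + 1"
        unfolding ps b0_def by (simp add: o_def interv_sum_list_conv_sum_set_nat del: upt_Suc sum.op_ivl_Suc)
      then have "DT_N T \<tau> ?xs = fact b0 * pair_value t (pair_up ?xs)" by (intro DT_N disjI2)
      then show ?thesis unfolding ps using pair_value_outer[of "j 1" "j r" n] range le by simp
    qed
    have other: "DT_N T \<tau> ([int (l (j i)) - 1] @ alternate k l (j i + 1) (j (i + 1)) @ [int (k (j (i + 1))) - 1]) =
        fact (b i) * excursion (j i) (j (i + 1))" if i: "i \<in> {1..<r}" for i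
    proof -
      let ?xs = "[int (l (j i)) - 1] @ alternate k l (j i + 1) (j (i + 1)) @ [int (k (j (i + 1))) - 1]"
      note ps = pair_up_shifted[of "int (l (j i)) - 1" k l "j i + 1" "j (i + 1)" "int (k (j (i + 1))) - 1"]
      have "int (b i) = sum_list (map fst (pair_up ?xs)) + 1"
        unfolding ps sum_fst_shifted b_def using less[OF i]
        by (simp add: interv_sum_list_conv_sum_set_nat sum.atLeast_Suc_lessThan)
      then have "DT_N T \<tau> ?xs = fact (b i) * pair_value t (pair_up ?xs)" by (intro DT_N disjI1)
      then show ?thesis unfolding ps pair_value_excursion[OF less[OF i]] .
    qed
    have "of_nat (Nom n l r j * (fact b0 * (\<Prod>i\<in>{1..<r}. fact (b i)))) = (fact m :: complex)"
      unfolding b0_def b_def m_def by (subst Nom_mult_facts[OF j]) (use r in auto)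
    then have Nom: "of_nat (Nom n l r j) * (fact b0 * (\<Prod>i\<in>{1..<r}. fact (b i))) = (fact m :: complex)"
      by (simp add: of_nat_fact)
    have others: "(\<Prod>i\<in>{1..<r}. DT_N T \<tau> ([int (l (j i)) - 1] @ alternate k l (j i + 1) (j (i + 1))
          @ [int (k (j (i + 1))) - 1])) = (\<Prod>i\<in>{1..<r}. fact (b i)) * (\<Prod>i\<in>{1..<r}. excursion (j i) (j (i + 1)))"
      unfolding prod.distrib[symmetric] by (rule prod.cong[OF refl other])
    show ?thesis
      unfolding first others Nom[symmetric] by (simp only: mult_ac)
  qed
  have "(\<Sum>r=1..n. \<Sum>j\<in>increasing_maps r n.
       of_nat (Nom n l r j) *
       (DT_N T \<tau> (alternate k l 1 (j 1)
                   @ [int (k (j 1)) - 1, int (l (j r)) - 1]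
                   @ alternate k l (j r + 1) (n + 1)) *
        (\<Prod>i\<in>{1..<r}.
           DT_N T \<tau> ([int (l (j i)) - 1]
                      @ alternate k l (j i + 1) (j (i + 1))
                      @ [int (k (j (i + 1))) - 1])))) =
    (\<Sum>r=1..n. \<Sum>j\<in>increasing_maps r n.
       fact m * (outer n (j 1) (j r) * (\<Prod>i\<in>{1..<r}. excursion (j i) (j (i + 1)))))"
    by (rule sum.cong[OF refl], rule sum.cong[OF refl], rule term_eq)
  also have "\<dots> = fact m * visit_sum t (stretch 1 (Suc n))"
    by (simp only: visit_sum_increasing_maps[OF assms(2)] sum_distrib_left)
  also have "\<dots> = fact (m + 1) * t (stretch 1 (Suc n))"
    \<comment> \<open>\<open>m\<close> is half the length of the word only if the word is balanced\<close>
  proof (cases "excess (stretch 1 (Suc n)) = 0")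
    case True
    then have "int (\<Sum>s=1..<Suc n. l s) = int (\<Sum>s=1..<Suc n. k s)"
      by (simp add: excess_stretch del: sum.op_ivl_Suc)
    then have "length (stretch 1 (Suc n)) = 2 * m" unfolding length_stretch m by linarith
    then show ?thesis by (simp add: limit_moments_visit_sum[OF t] field_simps)
  next
    case False
    then have "t (stretch 1 (Suc n)) = 0"
      by (rule visit_sum_unbalanced[OF limit_moments_visit_sum[OF t]])
    then show ?thesis by (simp add: limit_moments_visit_sum[OF t])
  qed
  finally show ?thesis unfolding lhs by (rule sym)
qed

end
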